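(* Let $d\ge 1$, $m_0,m_1\in\mathbb R^d$, $\Sigma_0,\Sigma_1\in\mathbb S_{++}^d$, $a,b>0$, $\tau_0,\tau_1>0$, and let $\mu_0=\mathcal N(m_0,\Sigma_0)$, $\mu_1=\mathcal N(m_1,\Sigma_1)$, $\alpha=a\mu_0$, $\beta=b\mu_1$. Let $\mathsf U_{\tau_0,\tau_1}(\alpha,\beta)$ be the value of the unbalanced transport problem $$\mathsf U_{\tau_0,\tau_1}(\alpha,\beta)=\inf_{\gamma\in\mathcal M_+(\mathbb R^d\times\mathbb R^d)}\left\{\int\|x-y\|^2\,\mathrm d\gamma(x,y)+\tau_0\,\mathrm{KL}(\gamma_0\mid\alpha)+\tau_1\,\mathrm{KL}(\gamma_1\mid\beta)\right\},$$ and let $L_*,P_*,Q_*,u_*,v_*,p_*,q_*,\mathcal A_*$ be the objects defined in the context from the data $(m_0,m_1,\Sigma_0,\Sigma_1,\tau_0,\tau_1)$. Then the matrices $P_*$ and $Q_*$ are positive definite. The unique minimizer of the functional $\gamma\mapsto\int\|x-y\|^2\,\mathrm d\gamma(x,y)+\tau_0\,\mathrm{KL}(\gamma_0\mid\alpha)+\tau_1\,\mathrm{KL}(\gamma_1\mid\beta)$ over $\gamma\in\mathcal M_+(\mathbb R^d\times\mathbb R^d)$ is $$\gamma_*=M_*\pi_*,\qquad M_*=a^{\tau_0/(\tau_0+\tau_1)}\,b^{\tau_1/(\tau_0+\tau_1)}\exp\left(-\frac{\mathcal A_*}{\tau_0+\tau_1}\right),$$ where $\pi_*$ is the Gaussian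 $W_2$-optimal coupling between $p_*$ and $q_*$. Equivalently, if $X\sim p_*$, then $$Y=v_*+L_*(X-u_* )$$ has law $q_*$, and $(X,Y)\sim\pi_*$. The coupling $\pi_*$ is a (generally degenerate) Gaussian measure on $\mathbb R^d\times\mathbb R^d$, supported on the graph $\{(x,y): y=v_*+L_*(x-u_* )\}$. The optimal value is $$\mathsf U_{\tau_0,\tau_1}(\alpha,\beta)=\tau_0a+\tau_1b-(\tau_0+\tau_1)M_*.$$
   Context: $\mathbb S_{++}^d$ is the cone of real symmetric positive definite $d\times d$ matrices and $I$ is the $d\times d$ identity matrix. $\mathcal N(m,\Sigma)$ is the Gaussian probability measure with mean $m$ and covariance $\Sigma$. $\mathcal M_+(E)$ is the cone of finite non-negative Borel measures on $E$. For $\gamma\in\mathcal M_+(\mathbb R^d\times\mathbb R^d)$, $\gamma_0$ and $\gamma_1$ denote its first and second marginals (push-forwards under $(x,y)\mapsto x$ and $(x,y)\mapsto y$). $W_2$ is the quadratic Wasserstein distance on Borel probability measures on $\mathbb R^d$ with finite second moment (cost $\|x-y\|^2$). For finite non-negative measures $\rho,\eta$ the generalized Kullback--Leibler divergence is $\mathrm{KL}(\rho\mid\eta)=\int(r\log r-r+1)\,\mathrm d\eta$ if $\rho\ll\eta$ with $r=\mathrm d\rho/\mathrm d\eta$, and $\mathrm{KL}(\rho\mid\eta)=+\infty$ if $\rho\not\ll\eta$. Definitions (all matrix square roots are principal square roots): $r_0=2/\tau_0$, $r_1=2/\tau_1$, $A_0=\Sigma_0^{-1}$, $A_1=\Sigma_1^{-1}$,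 $C_0=A_0+r_0I$, $C_1=A_1+r_1I$, $\kappa=r_1-r_0$; $$S_*=\tfrac12\left[\kappa I+\left(\kappa^2I+4C_1^{1/2}C_0C_1^{1/2}\right)^{1/2}\right],\qquad L_*=C_1^{-1/2}S_*C_1^{-1/2};$$ $$P_*=[A_0+r_0(I-L_* )]^{-1},\qquad Q_*=L_*P_*L_*;$$ $$h_*=(I+r_0\Sigma_0+r_1\Sigma_1)^{-1}(m_0-m_1),\qquad u_*=m_0-r_0\Sigma_0h_*,\qquad v_*=m_1+r_1\Sigma_1h_*;$$ $$p_*=\mathcal N(u_*,P_* ),\qquad q_*=\mathcal N(v_*,Q_* );$$ $$\mathcal A_*=W_2^2(p_*,q_* )+\tau_0\,\mathrm{KL}(p_*\mid\mu_0)+\tau_1\,\mathrm{KL}(q_*\mid\mu_1).$$ *)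

theory Defs
  imports "HOL-Probability.Probability"
begin

section \<open>Matrices\<close>

definition positive_semidefinite :: "real^'n^'n \<Rightarrow> bool" where
  "positive_semidefinite A \<longleftrightarrow> transpose A = A \<and> (\<forall>x. 0 \<le> x \<bullet> (A *v x))"

definition positive_definite :: "real^'n^'n \<Rightarrow> bool" where
  "positive_definite A \<longleftrightarrow> transpose A = A \<and> (\<forall>x. x \<noteq> 0 \<longrightarrow> 0 < x \<bullet> (A *v x))"

text \<open>Principal square root; meaningful for positive semidefinite \<open>A\<close>, where exactly one
  such root exists.\<close>

definition matrix_sqrt :: "real^'n^'n \<Rightarrow> real^'n^'n" where
  "matrix_sqrt A = (THE B. positive_semidefinite B \<and> B ** B = A)"

section \<open>Measures\<close>

text \<open>The nondegenerate normal law with mean \<open>m\<close> and positive definite covariance \<open>\<Sigma>\<close>.\<close>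

definition gaussian :: "real^'n \<Rightarrow> real^'n^'n \<Rightarrow> (real^'n) measure" where
  "gaussian m \<Sigma> = density lborel (\<lambda>x. ennreal
     (exp (- ((x - m) \<bullet> (matrix_inv \<Sigma> *v (x - m))) / 2) / sqrt ((2 * pi) ^ CARD('n) * det \<Sigma>)))"

text \<open>Gaussian measures that may be degenerate: every one-dimensional projection is a normal law
  or a point mass. The case \<open>v = 0\<close> forces total mass one.\<close>

definition is_gaussian :: "'a::euclidean_space measure \<Rightarrow> bool" where
  "is_gaussian \<mu> \<longleftrightarrow> sets \<mu> = sets borel \<and>
     (\<forall>v. (\<exists>m. distr \<mu> borel (\<lambda>x. x \<bullet> v) = return borel m) \<or>
          (\<exists>m s. 0 < s \<and>
             distr \<mu> borel (\<lambda>x. x \<bullet> v) = density lborel (\<lambda>t. ennreal (normal_density m s t))))"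

definition finite_borel_measures :: "'a::topological_space measure set" where
  "finite_borel_measures = {\<gamma>. sets \<gamma> = sets borel \<and> finite_measure \<gamma>}"

text \<open>The integrand \<open>r log r - r + 1\<close> is nonnegative for \<open>r \<ge> 0\<close> (with \<open>0 * ln 0 = 0\<close>), so the
  divergence is a nonnegative extended real.\<close>

definition KL :: "'a measure \<Rightarrow> 'a measure \<Rightarrow> ennreal" where
  "KL \<rho> \<eta> =
     (if absolutely_continuous \<eta> \<rho>
      then \<integral>\<^sup>+x. ennreal (let r = enn2real (RN_deriv \<eta> \<rho> x) in r * ln r - r + 1) \<partial>\<eta>
      else \<infinity>)"

section \<open>Balanced and unbalanced transport\<close>

abbreviation first_marginal ::
    "('a::topological_space \<times> 'b::topological_space) measure \<Rightarrow> 'a measure" where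
  "first_marginal \<gamma> \<equiv> distr \<gamma> borel fst"

abbreviation second_marginal ::
    "('a::topological_space \<times> 'b::topological_space) measure \<Rightarrow> 'b measure" where
  "second_marginal \<gamma> \<equiv> distr \<gamma> borel snd"

definition transport_cost :: "('a::euclidean_space \<times> 'a) measure \<Rightarrow> ennreal" where
  "transport_cost \<gamma> = (\<integral>\<^sup>+z. ennreal ((norm (fst z - snd z))\<^sup>2) \<partial>\<gamma>)"

definition couplings ::
    "'a::euclidean_space measure \<Rightarrow> 'a measure \<Rightarrow> ('a \<times> 'a) measure set" where
  "couplings p q =
     {\<pi>. sets \<pi> = sets borel \<and> first_marginal \<pi> = p \<and> second_marginal \<pi> = q}"

text \<open>The square of the quadratic Wasserstein distance.\<close>

definition W2_squared :: "'a::euclidean_space measure \<Rightarrow> 'a measure \<Rightarrow> ennreal" where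
  "W2_squared p q = (INF \<pi>\<in>couplings p q. transport_cost \<pi>)"

definition W2_optimal_coupling ::
    "'a::euclidean_space measure \<Rightarrow> 'a measure \<Rightarrow> ('a \<times> 'a) measure \<Rightarrow> bool" where
  "W2_optimal_coupling p q \<pi> \<longleftrightarrow> \<pi> \<in> couplings p q \<and> transport_cost \<pi> = W2_squared p q"

definition UOT_functional ::
    "real \<Rightarrow> real \<Rightarrow> 'a::euclidean_space measure \<Rightarrow> 'a measure \<Rightarrow> ('a \<times> 'a) measure \<Rightarrow> ennreal" where
  "UOT_functional \<tau>0 \<tau>1 \<alpha> \<beta> \<gamma> = transport_cost \<gamma>
     + ennreal \<tau>0 * KL (first_marginal \<gamma>) \<alpha> + ennreal \<tau>1 * KL (second_marginal \<gamma>) \<beta>"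

definition UOT_value ::
    "real \<Rightarrow> real \<Rightarrow> 'a::euclidean_space measure \<Rightarrow> 'a measure \<Rightarrow> ennreal" where
  "UOT_value \<tau>0 \<tau>1 \<alpha> \<beta> = (INF \<gamma>\<in>finite_borel_measures. UOT_functional \<tau>0 \<tau>1 \<alpha> \<beta> \<gamma>)"

section \<open>The explicit Gaussian solution\<close>

definition S_star :: "real^'n^'n \<Rightarrow> real^'n^'n \<Rightarrow> real \<Rightarrow> real \<Rightarrow> real^'n^'n" where
  "S_star \<Sigma>0 \<Sigma>1 \<tau>0 \<tau>1 =
    (let r0 = 2 / \<tau>0; r1 = 2 / \<tau>1; \<kappa> = r1 - r0;
         C0 = matrix_inv \<Sigma>0 + r0 *\<^sub>R mat 1; C1 = matrix_inv \<Sigma>1 + r1 *\<^sub>R mat 1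
     in (1 / 2) *\<^sub>R (\<kappa> *\<^sub>R mat 1 +
          matrix_sqrt (\<kappa>\<^sup>2 *\<^sub>R mat 1 + 4 *\<^sub>R (matrix_sqrt C1 ** C0 ** matrix_sqrt C1))))"

definition L_star :: "real^'n^'n \<Rightarrow> real^'n^'n \<Rightarrow> real \<Rightarrow> real \<Rightarrow> real^'n^'n" where
  "L_star \<Sigma>0 \<Sigma>1 \<tau>0 \<tau>1 =
    (let r1 = 2 / \<tau>1; C1 = matrix_inv \<Sigma>1 + r1 *\<^sub>R mat 1
     in matrix_inv (matrix_sqrt C1) ** S_star \<Sigma>0 \<Sigma>1 \<tau>0 \<tau>1 ** matrix_inv (matrix_sqrt C1))"

definition P_star :: "real^'n^'n \<Rightarrow> real^'n^'n \<Rightarrow> real \<Rightarrow> real \<Rightarrow> real^'n^'n" where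
  "P_star \<Sigma>0 \<Sigma>1 \<tau>0 \<tau>1 =
    (let r0 = 2 / \<tau>0
     in matrix_inv (matrix_inv \<Sigma>0 + r0 *\<^sub>R (mat 1 - L_star \<Sigma>0 \<Sigma>1 \<tau>0 \<tau>1)))"

definition Q_star :: "real^'n^'n \<Rightarrow> real^'n^'n \<Rightarrow> real \<Rightarrow> real \<Rightarrow> real^'n^'n" where
  "Q_star \<Sigma>0 \<Sigma>1 \<tau>0 \<tau>1 =
     L_star \<Sigma>0 \<Sigma>1 \<tau>0 \<tau>1 ** P_star \<Sigma>0 \<Sigma>1 \<tau>0 \<tau>1 ** L_star \<Sigma>0 \<Sigma>1 \<tau>0 \<tau>1"

definition h_star ::
    "real^'n \<Rightarrow> real^'n \<Rightarrow> real^'n^'n \<Rightarrow> real^'n^'n \<Rightarrow> real \<Rightarrow> real \<Rightarrow> real^'n" where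
  "h_star m0 m1 \<Sigma>0 \<Sigma>1 \<tau>0 \<tau>1 =
    (let r0 = 2 / \<tau>0; r1 = 2 / \<tau>1
     in matrix_inv (mat 1 + r0 *\<^sub>R \<Sigma>0 + r1 *\<^sub>R \<Sigma>1) *v (m0 - m1))"

definition u_star ::
    "real^'n \<Rightarrow> real^'n \<Rightarrow> real^'n^'n \<Rightarrow> real^'n^'n \<Rightarrow> real \<Rightarrow> real \<Rightarrow> real^'n" where
  "u_star m0 m1 \<Sigma>0 \<Sigma>1 \<tau>0 \<tau>1 =
    (let r0 = 2 / \<tau>0 in m0 - r0 *\<^sub>R (\<Sigma>0 *v h_star m0 m1 \<Sigma>0 \<Sigma>1 \<tau>0 \<tau>1))"

definition v_star ::
    "real^'n \<Rightarrow> real^'n \<Rightarrow> real^'n^'n \<Rightarrow> real^'n^'n \<Rightarrow> real \<Rightarrow> real \<Rightarrow> real^'n" where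
  "v_star m0 m1 \<Sigma>0 \<Sigma>1 \<tau>0 \<tau>1 =
    (let r1 = 2 / \<tau>1 in m1 + r1 *\<^sub>R (\<Sigma>1 *v h_star m0 m1 \<Sigma>0 \<Sigma>1 \<tau>0 \<tau>1))"

definition p_star ::
    "real^'n \<Rightarrow> real^'n \<Rightarrow> real^'n^'n \<Rightarrow> real^'n^'n \<Rightarrow> real \<Rightarrow> real \<Rightarrow> (real^'n) measure" where
  "p_star m0 m1 \<Sigma>0 \<Sigma>1 \<tau>0 \<tau>1 =
     gaussian (u_star m0 m1 \<Sigma>0 \<Sigma>1 \<tau>0 \<tau>1) (P_star \<Sigma>0 \<Sigma>1 \<tau>0 \<tau>1)"

definition q_star ::
    "real^'n \<Rightarrow> real^'n \<Rightarrow> real^'n^'n \<Rightarrow> real^'n^'n \<Rightarrow> real \<Rightarrow> real \<Rightarrow> (real^'n) measure" where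
  "q_star m0 m1 \<Sigma>0 \<Sigma>1 \<tau>0 \<tau>1 =
     gaussian (v_star m0 m1 \<Sigma>0 \<Sigma>1 \<tau>0 \<tau>1) (Q_star \<Sigma>0 \<Sigma>1 \<tau>0 \<tau>1)"

definition A_star ::
    "real^'n \<Rightarrow> real^'n \<Rightarrow> real^'n^'n \<Rightarrow> real^'n^'n \<Rightarrow> real \<Rightarrow> real \<Rightarrow> ennreal" where
  "A_star m0 m1 \<Sigma>0 \<Sigma>1 \<tau>0 \<tau>1 =
    (let p = p_star m0 m1 \<Sigma>0 \<Sigma>1 \<tau>0 \<tau>1; q = q_star m0 m1 \<Sigma>0 \<Sigma>1 \<tau>0 \<tau>1
     in W2_squared p q + ennreal \<tau>0 * KL p (gaussian m0 \<Sigma>0) + ennreal \<tau>1 * KL q (gaussian m1 \<Sigma>1))"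

end

theory Submission
  imports Defs
begin

text \<open>
  The value is bounded below by quadratic Kantorovich potentials. The functions
  \<open>\<phi> = - \<tau>\<^sub>0 log (dp\<^sub>* / d\<mu>\<^sub>0)\<close> and \<open>\<psi> = - \<tau>\<^sub>1 log (dq\<^sub>* / d\<mu>\<^sub>1)\<close> satisfy
  \<open>|x - y|\<^sup>2 - \<phi> x - \<psi> y = K + (y - T x) \<bullet> L\<^sub>*\<^sup>-\<^sup>1 (y - T x)\<close> with \<open>T x = v\<^sub>* + L\<^sub>* (x - u\<^sub>*)\<close>; the
  quadratic and linear parts of this identity are the Riccati equation \<open>L C\<^sub>1 L = C\<^sub>0 + \<kappa> L\<close> and
  \<open>u\<^sub>* - v\<^sub>* = h\<^sub>*\<close>, and integrating it against the coupling of \<open>p\<^sub>*\<close> and \<open>q\<^sub>*\<close> on the graph of \<open>T\<close>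
  identifies \<open>K\<close> with the constant \<open>A\<^sub>*\<close>. Suitable shifts of \<open>\<phi>\<close> and \<open>\<psi>\<close> absorb \<open>K\<close>. Integrating
  against a competitor and using the Fenchel inequality
  \<open>r log r - r + 1 + r t \<ge> 1 - exp (- t)\<close> for the two divergences gives the
  lower bound; equality forces \<open>y = T x\<close> almost everywhere and the first marginal \<open>M\<^sub>* p\<^sub>*\<close>.
\<close>

section \<open>Positive definite matrices\<close>

text \<open>The explicit formulas are forced by contact of the potentials with the cost along the
  graph of \<open>T\<close>. Contact means that the gradient of \<open>\<phi>\<close> at
  \<open>x\<close> is \<open>2 (x - T x)\<close> and that of \<open>\<psi>\<close> at
  \<open>y\<close> is \<open>2 (y - T\<^sup>-\<^sup>1 y)\<close>. Both potentials are scaled log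
  ratios of Gaussian densities, so the linear parts of these equations prescribe the precisions
  \<open>A0 + r0 (I - L)\<close> of the first marginal and
  \<open>A1 + r1 (I - L\<^sup>-\<^sup>1)\<close> of the second. Demanding that \<open>T\<close>
  carry one marginal to the other, \<open>Q = L P L\<close>, turns the two prescriptions into the
  Riccati equation for \<open>L\<close>. The constant parts read
  \<open>A0 (u - m0) = - r0 (u - v)\<close> and \<open>A1 (v - m1) = r1 (u - v)\<close>, and solving
  them for \<open>u - v\<close> gives \<open>h\<close>. The mass \<open>M\<close> comes from the
  shifts: they must add up to \<open>K\<close> and at the same time give both reweighted reference
  measures the same total mass. Since \<open>T\<close> pushes Gaussians to Gaussians only through a
  change of variables, the factor \<open>|det A|\<close> is established for Lebesgue measure
  beforehand.\<close>

lemma symmetric_matrix_inner: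
  fixes A :: "real^'n^'n"
  assumes "transpose A = A"
  shows "x \<bullet> (A *v y) = (A *v x) \<bullet> y"
  by (metis assms dot_lmul_matrix vector_transpose_matrix)

lemma symmetric_matrixI:
  fixes A :: "real^'n^'n"
  assumes "\<And>x y. x \<bullet> (A *v y) = (A *v x) \<bullet> y"
  shows "transpose A = A"
proof -
  have "adjoint ((*v) A) = (*v) A"
    by (rule adjoint_unique) (simp add: assms)
  then show ?thesis
    by (simp add: adjoint_matrix matrix_eq fun_eq_iff)
qed

section \<open>The spectral theorem for symmetric matrices\<close>

lemma nonneg_quadratic_linear_coeff_zero:
  fixes p q :: real
  assumes nn: "\<And>t. 0 \<le> 2 * t * p + t\<^sup>2 * q"
  shows "p = 0"
proof (rule ccontr)
  assume p: "p \<noteq> 0"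
  \<comment> \<open>The summand 1 keeps \<open>c\<close> positive when \<open>q = 0\<close>. At
    \<open>t = - p / c\<close> the polynomial is at most \<open>- (p\<^sup>2 / c)\<close>.\<close>
  define c where "c = 1 + \<bar>q\<bar>"
  have c: "0 < c" "q \<le> c" by (auto simp: c_def)
  have "0 \<le> 2 * (- p / c) * p + (- p / c)\<^sup>2 * q"
    using nn by blast
  also have "\<dots> \<le> 2 * (- p / c) * p + (- p / c)\<^sup>2 * c"
    using c by (intro add_left_mono mult_left_mono) auto
  also have "\<dots> = - (p\<^sup>2 / c)"
    using c by (simp add: field_simps power2_eq_square)
  also have "\<dots> < 0" using p c by (simp add: zero_less_divide_iff)
  finally show False by simp
qed

text \<open>A maximiser \<open>v\<close> of the Rayleigh quotient on the unit sphere of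
  \<open>S\<close> is an eigenvector: along the residual \<open>w = l v - A v\<close>, which lies in
  \<open>S\<close> by invariance, the nonnegative function
  \<open>l (x \<bullet> x) - x \<bullet> A x\<close> starts at zero with linear coefficient
  \<open>2 (w \<bullet> w)\<close>. Maximality is exported too, since
  \<open>positive_definite_eigenvaluesI\<close> needs an extremal eigenvalue.\<close>

lemma symmetric_eigenvector_in_subspace:
  fixes A :: "real^'n^'n"
  assumes sym: "transpose A = A" and S: "subspace S" "S \<noteq> {0}"
    and inv: "\<And>x. x \<in> S \<Longrightarrow> A *v x \<in> S"
  obtains v where "v \<in> S" "norm v = 1" "A *v v = (v \<bullet> (A *v v)) *\<^sub>R v"
    "\<And>x. x \<in> S \<Longrightarrow> x \<bullet> (A *v x) \<le> (v \<bullet> (A *v v)) * (x \<bullet> x)"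
proof -
  let ?K = "S \<inter> sphere 0 1"
  have "compact ?K"
    by (simp add: S closed_subspace closed_Int_compact)
  moreover have "?K \<noteq> {}"
  proof -
    obtain x where x: "x \<in> S" "x \<noteq> 0" using S subspace_0 by blast
    then have "x /\<^sub>R norm x \<in> ?K" using S by (simp add: subspace_scale)
    then show ?thesis by blast
  qed
  moreover have "continuous_on ?K (\<lambda>x. x \<bullet> (A *v x))"
    by (intro continuous_intros linear_continuous_on bounded_linear_intros) 
  ultimately obtain v where v: "v \<in> ?K" and max: "\<And>x. x \<in> ?K \<Longrightarrow> x \<bullet> (A *v x) \<le> v \<bullet> (A *v v)"
    using continuous_attains_sup by meson
  define l where "l = v \<bullet> (A *v v)"
  have nv: "norm v = 1" and vS: "v \<in> S" using v by auto
  have le: "x \<bullet> (A *v x) \<le> l * (x \<bullet> x)" if "x \<in> S" for x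
  proof (cases "x = 0")
    case False
    then have "x /\<^sub>R norm x \<in> ?K" using that S by (simp add: subspace_scale)
    from max[OF this] have "(x \<bullet> (A *v x)) / (norm x)\<^sup>2 \<le> l"
      by (simp add: l_def scaleR_matrix_vector_assoc[symmetric] matrix_vector_mult_scaleR
          power2_eq_square divide_inverse mult_ac)
    then show ?thesis using False by (simp add: divide_le_eq dot_square_norm)
  qed simp
  define w where "w = l *\<^sub>R v - A *v v"
  have wS: "w \<in> S" unfolding w_def using S vS inv by (simp add: subspace_diff subspace_scale)
  have "0 \<le> 2 * t * (w \<bullet> w) + t\<^sup>2 * (l * (w \<bullet> w) - w \<bullet> (A *v w))" for t
  proof -
    have "v + t *\<^sub>R w \<in> S" using vS wS S by (simp add: subspace_add subspace_scale)
    from le[OF this]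
    have "0 \<le> l * ((v + t *\<^sub>R w) \<bullet> (v + t *\<^sub>R w)) - (v + t *\<^sub>R w) \<bullet> (A *v (v + t *\<^sub>R w))" by simp
    also have "\<dots> = l * (v \<bullet> v) - v \<bullet> (A *v v) + 2 * t * (w \<bullet> (l *\<^sub>R v - A *v v))
        + t\<^sup>2 * (l * (w \<bullet> w) - w \<bullet> (A *v w))"
      by (simp add: matrix_vector_right_distrib matrix_vector_mult_scaleR inner_simps
          symmetric_matrix_inner[OF sym, of v w] inner_commute[of "A *v v" w]
          inner_commute[of v w] power2_eq_square algebra_simps)
    finally show ?thesis using nv by (simp add: l_def w_def dot_square_norm)
  qed
  then have "w \<bullet> w = 0" by (rule nonneg_quadratic_linear_coeff_zero)
  then have "A *v v = l *\<^sub>R v" by (simp add: w_def)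
  with that[OF vS nv] le show ?thesis unfolding l_def by blast
qed

lemma orthonormal_sum_inner:
  assumes fin: "finite B" and orth: "pairwise orthogonal B" and nrm: "\<And>b. b \<in> B \<Longrightarrow> norm b = 1"
    and c: "c \<in> B"
  shows "(\<Sum>b\<in>B. f b *\<^sub>R b) \<bullet> c = f c"
proof -
  have "(\<Sum>b\<in>B. f b *\<^sub>R b) \<bullet> c = (\<Sum>b\<in>B. if b = c then f c else 0)"
    unfolding inner_sum_left
    using orth nrm[OF c] c
    by (intro sum.cong) (auto simp: pairwise_def orthogonal_def dot_square_norm)
  then show ?thesis using fin c by simp
qed

text \<open>An orthonormal set of eigenvectors of largest cardinality spans: its orthogonal
  complement is invariant under \<open>A\<close>, so a nonzero complement would contain one more
  eigenvector. Independence of orthogonal families bounds the cardinality.\<close>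

theorem symmetric_matrix_eigenbasis:
  fixes A :: "real^'n^'n"
  assumes sym: "transpose A = A"
  obtains B l where "finite B" "pairwise orthogonal B" "\<And>b. b \<in> B \<Longrightarrow> norm b = 1"
    "\<And>b. b \<in> B \<Longrightarrow> A *v b = l b *\<^sub>R b" "\<And>x. x = (\<Sum>b\<in>B. (x \<bullet> b) *\<^sub>R b)"
proof -
  define P where "P B \<longleftrightarrow> finite B \<and> pairwise orthogonal B \<and>
    (\<forall>b\<in>B. norm b = 1 \<and> A *v b = (b \<bullet> (A *v b)) *\<^sub>R b)" for B
  have "P {}" by (simp add: P_def)
  moreover have "card B \<le> DIM(real^'n)" if "P B" for B
    using that independent_bound pairwise_orthogonal_independent unfolding P_def by fastforce
  ultimately obtain B where B: "P B" and max: "\<And>B'. P B' \<Longrightarrow> card B' \<le> card B"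
    using ex_has_greatest_nat[of P "{}" card "Suc (DIM(real^'n))"] by (auto simp: less_Suc_eq_le)
  define S where "S = {x. \<forall>b\<in>B. x \<bullet> b = 0}"
  have "subspace S" by (auto simp: S_def subspace_def inner_simps)
  moreover have inv: "A *v x \<in> S" if "x \<in> S" for x
  proof -
    have "(A *v x) \<bullet> b = 0" if "b \<in> B" for b
    proof -
      have "A *v b = (b \<bullet> (A *v b)) *\<^sub>R b" using B that by (simp add: P_def)
      then have "x \<bullet> (A *v b) = (b \<bullet> (A *v b)) * (x \<bullet> b)" by (metis inner_scaleR_right)
      then show ?thesis
        using \<open>x \<in> S\<close> that by (simp add: S_def symmetric_matrix_inner[OF sym, symmetric])
    qed
    then show ?thesis by (simp add: S_def)
  qed
  moreover have "S = {0}"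
  proof (rule ccontr)
    assume "S \<noteq> {0}"
    then obtain v where v: "v \<in> S" "norm v = 1" "A *v v = (v \<bullet> (A *v v)) *\<^sub>R v"
      by (rule symmetric_eigenvector_in_subspace[OF sym \<open>subspace S\<close> _ inv])
    have "v \<notin> B" using v by (auto simp: S_def)
    moreover have "P (insert v B)"
      using B v by (auto simp: P_def pairwise_insert S_def orthogonal_def inner_commute)
    ultimately show False using max[of "insert v B"] B by (simp add: P_def)
  qed
  moreover have "x = (\<Sum>b\<in>B. (x \<bullet> b) *\<^sub>R b)" for x
  proof -
    have "x - (\<Sum>b\<in>B. (x \<bullet> b) *\<^sub>R b) \<in> S"
      using B by (simp add: S_def P_def inner_diff_left orthonormal_sum_inner)
    then show ?thesis using \<open>S = {0}\<close> by simp
  qed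
  ultimately show ?thesis using that[of B "\<lambda>b. b \<bullet> (A *v b)"] B by (auto simp: P_def)
qed

section \<open>Principal square roots\<close>

lemma positive_semidefinite_sqrt_unique:
  fixes B C :: "real^'n^'n"
  assumes B: "positive_semidefinite B" and C: "positive_semidefinite C" and eq: "B ** B = C ** C"
  shows "B = C"
proof -
  have symB: "transpose B = B" and symC: "transpose C = C"
    using B C by (auto simp: positive_semidefinite_def)
  \<comment> \<open>The two roots are not known to commute, so they cannot be diagonalised together.
    Their difference is diagonalised instead: equal squares give \<open>B D = - D C\<close>, and on
    an eigenvector of \<open>D\<close> with nonzero eigenvalue this makes the quadratic forms of
    \<open>B\<close> and \<open>C\<close> add up to zero. Both are nonnegative, so both vanish, and
    then so does the eigenvalue.\<close>
  define D where "D x = B *v x - C *v x" for x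
  have symD: "x \<bullet> D y = D x \<bullet> y" for x y
    by (simp add: D_def inner_diff_left inner_diff_right symmetric_matrix_inner[OF symB]
        symmetric_matrix_inner[OF symC])
  have linD: "D (x - y) = D x - D y" for x y
    by (simp add: D_def matrix_vector_mult_diff_distrib)
  have syl: "B *v D x = - D (C *v x)" for x
    using eq by (simp add: D_def matrix_vector_mult_diff_distrib matrix_vector_mul_assoc)
  have "transpose (B - C) = B - C"
    by (rule symmetric_matrixI) (use symD in \<open>simp add: D_def matrix_vector_mult_diff_rdistrib\<close>)
  then obtain E l where E: "finite E" "pairwise orthogonal E" "\<And>b. b \<in> E \<Longrightarrow> norm b = 1"
      "\<And>b. b \<in> E \<Longrightarrow> (B - C) *v b = l b *\<^sub>R b" "\<And>x. x = (\<Sum>b\<in>E. (x \<bullet> b) *\<^sub>R b)"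
    by (erule_tac symmetric_matrix_eigenbasis) blast
  have l0: "l b = 0" if b: "b \<in> E" for b
  proof (rule ccontr)
    assume nz: "l b \<noteq> 0"
    have Db: "D b = l b *\<^sub>R b" using E(4)[OF b] by (simp add: D_def matrix_vector_mult_diff_rdistrib)
    have "l b * (b \<bullet> (B *v b)) = b \<bullet> (B *v D b)"
      by (simp add: Db matrix_vector_mult_scaleR)
    also have "\<dots> = - (D b \<bullet> (C *v b))" by (simp add: syl symD)
    also have "\<dots> = - l b * (b \<bullet> (C *v b))" by (simp add: Db)
    finally have "l b * (b \<bullet> (B *v b) + b \<bullet> (C *v b)) = 0" by (simp add: distrib_left)
    then have "b \<bullet> (B *v b) + b \<bullet> (C *v b) = 0" using nz by simp
    moreover have "0 \<le> b \<bullet> (B *v b)" "0 \<le> b \<bullet> (C *v b)"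
      using B C by (auto simp: positive_semidefinite_def)
    ultimately have "b \<bullet> (B *v b) - b \<bullet> (C *v b) = 0" by linarith
    then have "b \<bullet> D b = 0" by (simp add: D_def inner_diff_right)
    then show False using nz E(3)[OF b] by (simp add: Db dot_square_norm)
  qed
  have "(B - C) *v x = 0" for x
  proof -
    have "(B - C) *v x = (B - C) *v (\<Sum>b\<in>E. (x \<bullet> b) *\<^sub>R b)" using E(5)[of x] by simp
    also have "\<dots> = (\<Sum>b\<in>E. (x \<bullet> b) *\<^sub>R ((B - C) *v b))"
      by (simp add: linear_sum[OF matrix_vector_mul_linear] matrix_vector_mult_scaleR)
    also have "\<dots> = 0" using E(4) l0 by simp
    finally show ?thesis .
  qed
  then show ?thesis by (simp add: matrix_eq matrix_vector_mult_diff_rdistrib)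
qed

lemma positive_semidefinite_sqrt_exists:
  fixes A :: "real^'n^'n"
  assumes A: "positive_semidefinite A"
  shows "\<exists>B. positive_semidefinite B \<and> B ** B = A"
proof -
  have "transpose A = A" using A by (simp add: positive_semidefinite_def)
  then obtain E l where E: "finite E" "pairwise orthogonal E" "\<And>b. b \<in> E \<Longrightarrow> norm b = 1"
      "\<And>b. b \<in> E \<Longrightarrow> A *v b = l b *\<^sub>R b" "\<And>x. x = (\<Sum>b\<in>E. (x \<bullet> b) *\<^sub>R b)"
    by (erule_tac symmetric_matrix_eigenbasis) blast
  have l: "0 \<le> l b" if "b \<in> E" for b
  proof -
    have "0 \<le> b \<bullet> (A *v b)" using A by (simp add: positive_semidefinite_def)
    then show ?thesis using E(3,4)[OF that] by (simp add: dot_square_norm)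
  qed
  define F where "F x = (\<Sum>b\<in>E. (sqrt (l b) * (x \<bullet> b)) *\<^sub>R b)" for x :: "real^'n"
  have "linear F"
    by (rule linearI) (simp_all add: F_def inner_simps sum.distrib scaleR_sum_right algebra_simps)
  then have F: "matrix F *v x = F x" for x by (simp add: matrix_works)
  have Fb: "F x \<bullet> b = sqrt (l b) * (x \<bullet> b)" if "b \<in> E" for x b
    unfolding F_def by (rule orthonormal_sum_inner[OF E(1,2,3) that])
  have "transpose (matrix F) = matrix F"
    by (rule symmetric_matrixI)
      (simp add: F, simp add: F_def inner_sum_left inner_sum_right mult_ac inner_commute)
  moreover have "0 \<le> x \<bullet> (matrix F *v x)" for x
  proof -
    have "x \<bullet> F x = (\<Sum>b\<in>E. sqrt (l b) * (x \<bullet> b)\<^sup>2)"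
      by (simp add: F_def inner_sum_right power2_eq_square mult_ac)
    then show ?thesis by (simp add: F l sum_nonneg)
  qed
  moreover have "matrix F ** matrix F = A"
  proof -
    have "F (F x) = A *v x" for x
    proof -
      have "A *v x = A *v (\<Sum>b\<in>E. (x \<bullet> b) *\<^sub>R b)" using E(5)[of x] by simp
      also have "\<dots> = (\<Sum>b\<in>E. (x \<bullet> b) *\<^sub>R (A *v b))"
        by (simp add: linear_sum[OF matrix_vector_mul_linear] matrix_vector_mult_scaleR)
      also have "\<dots> = (\<Sum>b\<in>E. (sqrt (l b) * (F x \<bullet> b)) *\<^sub>R b)"
        using E(4) l by (intro sum.cong) (simp_all add: Fb)
      finally show ?thesis by (simp add: F_def)
    qed
    then show ?thesis by (simp add: matrix_eq matrix_vector_mul_assoc[symmetric] F)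
  qed
  ultimately show ?thesis unfolding positive_semidefinite_def by blast
qed

lemma matrix_sqrt:
  fixes A :: "real^'n^'n"
  assumes "positive_semidefinite A"
  shows "positive_semidefinite (matrix_sqrt A)" "matrix_sqrt A ** matrix_sqrt A = A"
proof -
  have "\<exists>!B. positive_semidefinite B \<and> B ** B = A"
    using positive_semidefinite_sqrt_exists[OF assms] positive_semidefinite_sqrt_unique by metis
  from theI'[OF this] show "positive_semidefinite (matrix_sqrt A)" "matrix_sqrt A ** matrix_sqrt A = A"
    unfolding matrix_sqrt_def by auto
qed


section \<open>Inverses and the cone of positive definite matrices\<close>

lemma matrix_inv_mult:
  fixes A :: "real^'n^'n"
  assumes "invertible A"
  shows "A ** matrix_inv A = mat 1" "matrix_inv A ** A = mat 1"
proof -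
  from assms have "\<exists>A'. A ** A' = mat 1 \<and> A' ** A = mat 1" by (simp add: invertible_def)
  from someI_ex[OF this] show "A ** matrix_inv A = mat 1" "matrix_inv A ** A = mat 1"
    by (simp_all add: matrix_inv_def)
qed

lemma matrix_inv_vector:
  fixes A :: "real^'n^'n"
  assumes "invertible A"
  shows "A *v (matrix_inv A *v x) = x" "matrix_inv A *v (A *v x) = x"
  using matrix_inv_mult[OF assms] by (simp_all add: matrix_vector_mul_assoc)

lemma matrix_inv_unique:
  fixes A :: "real^'n^'n"
  assumes "A ** B = mat 1"
  shows "matrix_inv A = B"
proof -
  have "invertible A" using assms invertible_right_inverse by blast
  then have "matrix_inv A ** (A ** B) = B" by (simp add: matrix_mul_assoc matrix_inv_mult)
  then show ?thesis by (simp add: assms)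
qed

lemma invertible_matrix_inv:
  fixes A :: "real^'n^'n"
  assumes "invertible A"
  shows "invertible (matrix_inv A)"
  using matrix_inv_mult[OF assms] unfolding invertible_def by blast

lemma matrix_inv_matrix_inv:
  fixes A :: "real^'n^'n"
  assumes "invertible A"
  shows "matrix_inv (matrix_inv A) = A"
  by (rule matrix_inv_unique) (rule matrix_inv_mult[OF assms])

lemma positive_definite_imp_semidefinite:
  "positive_definite A \<Longrightarrow> positive_semidefinite A"
  unfolding positive_definite_def positive_semidefinite_def
  by (metis inner_zero_left less_eq_real_def)

lemma positive_definite_symmetric: "positive_definite A \<Longrightarrow> transpose A = A"
  by (simp add: positive_definite_def)

lemma positive_definite_inner_pos: "positive_definite A \<Longrightarrow> x \<noteq> 0 \<Longrightarrow> 0 < x \<bullet> (A *v x)"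
  by (simp add: positive_definite_def)

lemma positive_definite_inner_eq_0_iff:
  "positive_definite A \<Longrightarrow> x \<bullet> (A *v x) = 0 \<longleftrightarrow> x = 0"
  unfolding positive_definite_def by (metis inner_zero_left less_irrefl)

lemma positive_definite_inner_nonneg: "positive_definite A \<Longrightarrow> 0 \<le> x \<bullet> (A *v x)"
  using positive_definite_imp_semidefinite unfolding positive_semidefinite_def by blast

lemma positive_definite_invertible:
  assumes "positive_definite A"
  shows "invertible A"
proof -
  have "x = 0" if "A *v x = 0" for x
    using positive_definite_inner_eq_0_iff[OF assms, of x] that by simp
  then show ?thesis
    by (simp add: invertible_left_inverse matrix_left_invertible_ker)
qed

lemma positive_definite_mat_1: "positive_definite (mat 1)"
  by (simp add: positive_definite_def transpose_mat)

lemma positive_definite_add: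
  fixes A B :: "real^'n^'n"
  assumes "positive_definite A" "positive_semidefinite B"
  shows "positive_definite (A + B)"
proof -
  have "transpose (A + B) = A + B"
    using assms by (intro symmetric_matrixI)
      (simp add: matrix_vector_mult_add_rdistrib inner_simps positive_definite_def
        positive_semidefinite_def symmetric_matrix_inner)
  then show ?thesis
    using assms by (auto simp: positive_definite_def positive_semidefinite_def
        matrix_vector_mult_add_rdistrib inner_simps add_pos_nonneg)
qed

lemma positive_semidefinite_scaleR:
  fixes A :: "real^'n^'n"
  assumes "positive_semidefinite A" "0 \<le> c"
  shows "positive_semidefinite (c *\<^sub>R A)"
  using assms by (simp add: positive_semidefinite_def transpose_scalar
      scaleR_matrix_vector_assoc[symmetric])

lemma positive_definite_scaleR:
  fixes A :: "real^'n^'n"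
  assumes "positive_definite A" "0 < c"
  shows "positive_definite (c *\<^sub>R A)"
  using assms by (simp add: positive_definite_def transpose_scalar
      scaleR_matrix_vector_assoc[symmetric])

lemma positive_definite_congruence:
  fixes A B :: "real^'n^'n"
  assumes A: "positive_definite A" and B: "invertible B" "transpose B = B"
  shows "positive_definite (B ** A ** B)"
proof -
  have "B *v x \<noteq> 0" if "x \<noteq> 0" for x
    by (metis B(1) matrix_inv_vector(2) matrix_vector_mult_0_right that)
  then show ?thesis
    using A B by (auto simp: positive_definite_def matrix_transpose_mul matrix_mul_assoc
        matrix_vector_mul_assoc[symmetric] symmetric_matrix_inner[of B])
qed

lemma positive_definite_matrix_inv:
  fixes A :: "real^'n^'n"
  assumes A: "positive_definite A"
  shows "positive_definite (matrix_inv A)"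
proof -
  note inv = positive_definite_invertible[OF A]
  have sym: "transpose (matrix_inv A) = matrix_inv A"
  proof (rule symmetric_matrixI)
    fix x y
    show "x \<bullet> (matrix_inv A *v y) = (matrix_inv A *v x) \<bullet> y"
      by (metis inv matrix_inv_vector(1) positive_definite_symmetric[OF A] symmetric_matrix_inner)
  qed
  have "positive_definite (matrix_inv A ** A ** matrix_inv A)"
    using A sym inv by (intro positive_definite_congruence invertible_matrix_inv)
  then show ?thesis by (simp add: matrix_inv_mult[OF inv])
qed

lemma positive_definite_sqrt:
  fixes A :: "real^'n^'n"
  assumes A: "positive_definite A"
  shows "positive_definite (matrix_sqrt A)"
proof -
  define R where "R = matrix_sqrt A"
  note psd = positive_definite_imp_semidefinite[OF A]
  have R: "positive_semidefinite R" "R ** R = A"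
    using matrix_sqrt[OF psd] by (simp_all add: R_def)
  \<comment> \<open>A root of the root: \<open>x \<bullet> R x\<close> is the squared norm of
    \<open>T x\<close>, so if it vanishes then \<open>T x\<close>, \<open>R x\<close> and
    \<open>A x\<close> vanish in turn.\<close>
  define T where "T = matrix_sqrt R"
  have T: "positive_semidefinite T" "T ** T = R"
    using matrix_sqrt[OF R(1)] by (simp_all add: T_def)
  have "x = 0" if "x \<bullet> (R *v x) = 0" for x
  proof -
    have "x \<bullet> (R *v x) = (T *v x) \<bullet> (T *v x)"
      using T unfolding positive_semidefinite_def
      by (metis matrix_vector_mul_assoc symmetric_matrix_inner)
    then have "T *v x = 0" using that by simp
    then have "R *v x = 0" using T(2) by (metis matrix_vector_mul_assoc matrix_vector_mult_0_right)
    then have "A *v x = 0" using R(2) by (metis matrix_vector_mul_assoc matrix_vector_mult_0_right)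
    then show "x = 0" using positive_definite_inner_eq_0_iff[OF A, of x] by simp
  qed
  then show ?thesis
    using R(1) unfolding R_def positive_definite_def positive_semidefinite_def
    by (metis less_eq_real_def)
qed

text \<open>The Rayleigh maximum of \<open>- A\<close> sits at an eigenvector for the least
  eigenvalue of \<open>A\<close>, and that eigenvalue bounds the quadratic form of \<open>A\<close>
  from below. The criterion is meant for \<open>S_star\<close>, whose eigenvalues are controlled by
  a scalar quadratic equation.\<close>

lemma positive_definite_eigenvaluesI:
  fixes A :: "real^'n^'n"
  assumes sym: "transpose A = A"
    and pos: "\<And>v l. norm v = 1 \<Longrightarrow> A *v v = l *\<^sub>R v \<Longrightarrow> 0 < l"
  shows "positive_definite A"
proof -
  have neg: "(- A) *v x = - (A *v x)" for x
    using matrix_vector_mult_diff_rdistrib[of 0 A x] by simp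
  have "transpose (- A) = - A"
    by (rule symmetric_matrixI) (simp add: neg symmetric_matrix_inner[OF sym])
  moreover have "(UNIV :: (real^'n) set) \<noteq> {0}"
    by (metis UNIV_I axis_eq_0_iff singletonD zero_neq_one)
  ultimately obtain v where v: "norm v = 1" "(- A) *v v = (v \<bullet> ((- A) *v v)) *\<^sub>R v"
    "\<And>x. x \<bullet> ((- A) *v x) \<le> (v \<bullet> ((- A) *v v)) * (x \<bullet> x)"
    using symmetric_eigenvector_in_subspace[of "- A" UNIV] by (metis UNIV_I subspace_UNIV)
  have "A *v v = (v \<bullet> (A *v v)) *\<^sub>R v" using v(2) by (simp add: neg)
  then have "0 < v \<bullet> (A *v v)" using pos v(1) by blast
  moreover have "(v \<bullet> (A *v v)) * (x \<bullet> x) \<le> x \<bullet> (A *v x)" for x using v(3)[of x] by (simp add: neg)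
  ultimately show ?thesis using sym unfolding positive_definite_def
    by (metis inner_gt_zero_iff less_le_trans mult_pos_pos)
qed

lemma positive_definite_coercive:
  fixes A :: "real^'n^'n"
  assumes A: "positive_definite A"
  obtains c where "0 < c" "\<And>x. c * (norm x)\<^sup>2 \<le> x \<bullet> (A *v x)"
proof -
  have "compact (sphere 0 1 :: (real^'n) set)" by simp
  moreover have "sphere 0 1 \<noteq> ({} :: (real^'n) set)" by simp
  moreover have "continuous_on (sphere 0 1) (\<lambda>x. x \<bullet> (A *v x))"
    by (intro continuous_intros linear_continuous_on bounded_linear_intros)
  ultimately obtain v where v: "v \<in> sphere 0 1"
    and min: "\<And>x. x \<in> sphere 0 1 \<Longrightarrow> v \<bullet> (A *v v) \<le> x \<bullet> (A *v x)"
    using continuous_attains_inf by meson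
  have "v \<noteq> 0" using v by auto
  have "v \<bullet> (A *v v) * (norm x)\<^sup>2 \<le> x \<bullet> (A *v x)" for x
  proof (cases "x = 0")
    case False
    then have "v \<bullet> (A *v v) \<le> (x /\<^sub>R norm x) \<bullet> (A *v (x /\<^sub>R norm x))" by (intro min) simp
    also have "\<dots> = (x \<bullet> (A *v x)) / (norm x)\<^sup>2"
      by (simp add: matrix_vector_mult_scaleR power2_eq_square divide_inverse mult_ac)
    finally show ?thesis using False by (simp add: le_divide_eq)
  qed simp
  then show ?thesis using that positive_definite_inner_pos[OF A \<open>v \<noteq> 0\<close>] by blast
qed

lemma det_positive_definite_pos:
  fixes A :: "real^'n^'n"
  assumes A: "positive_definite A"
  shows "0 < det A"
proof -
  have "det A = (det (matrix_sqrt A))\<^sup>2"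
    using matrix_sqrt(2)[OF positive_definite_imp_semidefinite[OF A]]
    by (metis det_mul power2_eq_square)
  moreover have "det (matrix_sqrt A) \<noteq> 0"
    using positive_definite_invertible[OF positive_definite_sqrt[OF A]]
    by (simp add: invertible_det_nz)
  ultimately show ?thesis by simp
qed

section \<open>Linear images of Lebesgue measure\<close>

lemma borel_measurable_matrix_vector_mult [measurable (raw)]:
  fixes A :: "real^'n^'m"
  assumes "f \<in> borel_measurable M"
  shows "(\<lambda>x. A *v f x) \<in> borel_measurable M"
  using borel_measurable_continuous_onI[OF linear_continuous_on[OF matrix_vector_mul_bounded_linear[of A]]] assms
  by (rule measurable_compose_rev)

lemma nn_integral_lborel_translate:
  fixes t :: "'a::euclidean_space"
  assumes [measurable]: "g \<in> borel_measurable borel"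
  shows "(\<integral>\<^sup>+x. g (t + x) \<partial>lborel) = (\<integral>\<^sup>+x. g x \<partial>lborel)"
  by (subst (2) lborel_distr_plus[of t, symmetric]) (simp add: nn_integral_distr)

lemma nn_integral_lborel_reflect:
  fixes t :: "'a::euclidean_space"
  assumes [measurable]: "g \<in> borel_measurable borel"
  shows "(\<integral>\<^sup>+x. g (t - x) \<partial>lborel) = (\<integral>\<^sup>+x. g x \<partial>lborel)"
  by (subst (2) lborel_affine[of "-1" t]) (simp_all add: nn_integral_density nn_integral_distr)

text \<open>Uniqueness of Haar measure, specialised to linear images of Lebesgue measure.\<close>

lemma nn_integral_lborel_matrix_exchange:
  fixes A :: "real^'n^'n"
  assumes A: "invertible A"
    and [measurable]: "f \<in> borel_measurable borel" "g \<in> borel_measurable borel"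
  shows "(\<integral>\<^sup>+x. f x \<partial>lborel) * (\<integral>\<^sup>+y. g (A *v y) \<partial>lborel)
       = (\<integral>\<^sup>+x. g x \<partial>lborel) * (\<integral>\<^sup>+y. f (A *v y) \<partial>lborel)"
proof -
  note inv = matrix_inv_vector[OF A]
  \<comment> \<open>Translation invariance lets \<open>x\<close> enter the inner integral as
    \<open>A (A\<^sup>-\<^sup>1 x + y) = x + A y\<close> without changing its value. After Fubini, a
    shift by \<open>A y\<close> moves the coupling from \<open>g\<close> to
    \<open>f\<close>.\<close>
  have "(\<integral>\<^sup>+x. f x \<partial>lborel) * (\<integral>\<^sup>+y. g (A *v y) \<partial>lborel)
      = (\<integral>\<^sup>+x. f x * (\<integral>\<^sup>+y. g (A *v (matrix_inv A *v x + y)) \<partial>lborel) \<partial>lborel)"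
    by (subst nn_integral_lborel_translate) (simp_all add: nn_integral_multc)
  also have "\<dots> = (\<integral>\<^sup>+x. \<integral>\<^sup>+y. f x * g (A *v y + x) \<partial>lborel \<partial>lborel)"
    by (simp add: nn_integral_cmult[symmetric] matrix_vector_right_distrib inv add.commute)
  also have "\<dots> = (\<integral>\<^sup>+y. \<integral>\<^sup>+x. f x * g (A *v y + x) \<partial>lborel \<partial>lborel)"
    by (rule lborel_pair.Fubini'[symmetric]) simp
  also have "\<dots> = (\<integral>\<^sup>+y. \<integral>\<^sup>+x. f (x - A *v y) * g x \<partial>lborel \<partial>lborel)"
  proof (rule nn_integral_cong)
    fix y
    show "(\<integral>\<^sup>+x. f x * g (A *v y + x) \<partial>lborel) = (\<integral>\<^sup>+x. f (x - A *v y) * g x \<partial>lborel)"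
      using nn_integral_lborel_translate[of "\<lambda>x. f (x - A *v y) * g x" "A *v y"] by simp
  qed
  also have "\<dots> = (\<integral>\<^sup>+x. \<integral>\<^sup>+y. f (x - A *v y) * g x \<partial>lborel \<partial>lborel)"
    by (rule lborel_pair.Fubini') simp
  \<comment> \<open>Now \<open>f (x - A y) = f (A (A\<^sup>-\<^sup>1 x - y))\<close>, and a
    reflection of \<open>y\<close> removes \<open>x\<close> from the inner integral.\<close>
  also have "\<dots> = (\<integral>\<^sup>+x. g x * (\<integral>\<^sup>+y. f (A *v (matrix_inv A *v x - y)) \<partial>lborel) \<partial>lborel)"
    by (simp add: nn_integral_cmult[symmetric] matrix_vector_mult_diff_distrib inv mult.commute)
  also have "\<dots> = (\<integral>\<^sup>+x. g x \<partial>lborel) * (\<integral>\<^sup>+y. f (A *v y) \<partial>lborel)"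
    by (subst nn_integral_lborel_reflect[where g = "\<lambda>y. f (A *v y)"]) (simp_all add: nn_integral_multc)
  finally show ?thesis .
qed

text \<open>The number \<open>c\<close> will turn out to be \<open>|det A|\<close>. As a relation
  between \<open>A\<close> and \<open>c\<close>, the change of variables formula can be multiplied
  and tested for uniqueness before any determinant appears.\<close>

definition volume_factor :: "real^'n^'n \<Rightarrow> real \<Rightarrow> bool" where
  "volume_factor A c \<longleftrightarrow> 0 < c \<and>
    (\<forall>g \<in> borel_measurable borel. ennreal c * (\<integral>\<^sup>+x. g (A *v x) \<partial>lborel) = (\<integral>\<^sup>+x. g x \<partial>lborel))"

lemma volume_factorD:
  "volume_factor A c \<Longrightarrow> g \<in> borel_measurable borel \<Longrightarrow>
    ennreal c * (\<integral>\<^sup>+x. g (A *v x) \<partial>lborel) = (\<integral>\<^sup>+x. g x \<partial>lborel)"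
  by (simp add: volume_factor_def)

text \<open>This supplies a test function whose integral may be cancelled in \<open>ennreal\<close>,
  being neither zero nor infinite. The ball is also invariant under isometries.\<close>

lemma nn_integral_unit_ball:
  defines "F \<equiv> indicator (ball 0 1) :: real^'n \<Rightarrow> ennreal"
  obtains m where "0 < m" "(\<integral>\<^sup>+x. F x \<partial>lborel) = ennreal m"
proof -
  have "(\<integral>\<^sup>+x. F x \<partial>lborel) = emeasure lborel (ball (0::real^'n) 1)"
    by (simp add: F_def)
  moreover have "emeasure lborel (ball (0::real^'n) 1) \<noteq> 0"
    using open_not_negligible[of "ball (0::real^'n) 1"]
    by (auto simp: negligible_iff_null_sets null_sets_def)
  moreover have "emeasure lborel (ball (0::real^'n) 1) < \<infinity>"
    by (rule emeasure_lborel_ball_finite)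
  ultimately show ?thesis
    using that[of "enn2real (\<integral>\<^sup>+x. F x \<partial>lborel)"]
    by (simp add: enn2real_positive_iff zero_less_iff_neq_zero)
qed

text \<open>Exchanging \<open>g\<close> with the ball indicator \<open>F\<close> yields
  \<open>c = m / k\<close>, where \<open>k\<close> is the integral of \<open>F\<close> composed with
  \<open>A\<close>. It remains to see that \<open>k\<close> is neither zero nor infinite; finiteness
  holds because the preimage of the ball lies in its bounded image under the inverse.\<close>

lemma volume_factor_exists:
  fixes A :: "real^'n^'n"
  assumes A: "invertible A"
  shows "\<exists>c. volume_factor A c"
proof -
  define F :: "real^'n \<Rightarrow> ennreal" where "F = indicator (ball 0 1)"
  have [measurable]: "F \<in> borel_measurable borel" by (auto simp: F_def intro!: borel_measurable_indicator)
  obtain m where m: "0 < m" "(\<integral>\<^sup>+x. F x \<partial>lborel) = ennreal m"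
    using nn_integral_unit_ball unfolding F_def by blast
  let ?k = "\<integral>\<^sup>+x. F (A *v x) \<partial>lborel"
  have eq: "ennreal m * (\<integral>\<^sup>+y. g (A *v y) \<partial>lborel) = (\<integral>\<^sup>+x. g x \<partial>lborel) * ?k"
    if "g \<in> borel_measurable borel" for g
    using nn_integral_lborel_matrix_exchange[OF A _ that, of F] m by simp
  \<comment> \<open>The constant 1 has infinite integral on both sides, so \<open>k = 0\<close>
    would give \<open>m * \<infinity> = 0\<close>.\<close>
  have "?k \<noteq> 0"
    using eq[of "\<lambda>_. 1"] m by (auto simp: emeasure_lborel_UNIV ennreal_mult_eq_top_iff)
  moreover have "?k < \<infinity>"
  proof -
    have "?k = emeasure lborel {x. A *v x \<in> ball 0 1}"
    proof -
      have "{x. A *v x \<in> ball 0 1} \<in> sets borel" unfolding mem_ball_0 by measurable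
      moreover have "?k = (\<integral>\<^sup>+x. indicator {x. A *v x \<in> ball 0 1} x \<partial>lborel)"
        by (auto simp: F_def indicator_def intro!: nn_integral_cong)
      ultimately show ?thesis by simp
    qed
    also have "\<dots> < \<infinity>"
    proof -
      have "bounded ((*v) (matrix_inv A) ` ball 0 1)"
        by (intro bounded_linear_image bounded_ball matrix_vector_mul_bounded_linear)
      moreover have "{x. A *v x \<in> ball 0 1} \<subseteq> (*v) (matrix_inv A) ` ball 0 1"
      proof
        fix x assume "x \<in> {x. A *v x \<in> ball 0 1}"
        then show "x \<in> (*v) (matrix_inv A) ` ball 0 1"
          by (intro image_eqI[of _ _ "A *v x"]) (simp_all add: matrix_inv_vector(2)[OF A])
      qed
      ultimately have "bounded {x. A *v x \<in> ball 0 1}" by (rule bounded_subset)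
      then show ?thesis by (rule emeasure_bounded_finite)
    qed
    finally show ?thesis .
  qed
  ultimately obtain k where k: "0 < k" "?k = ennreal k"
    by (metis enn2real_positive_iff ennreal_enn2real_if infinity_ennreal_def less_irrefl zero_less_iff_neq_zero)
  have "ennreal (m / k) * (\<integral>\<^sup>+y. g (A *v y) \<partial>lborel) = (\<integral>\<^sup>+x. g x \<partial>lborel)"
    if "g \<in> borel_measurable borel" for g
  proof -
    have "ennreal (m / k) * (\<integral>\<^sup>+y. g (A *v y) \<partial>lborel)
        = ennreal (1 / k) * (ennreal m * (\<integral>\<^sup>+y. g (A *v y) \<partial>lborel))"
      using k m by (simp add: ennreal_mult'[symmetric] mult.assoc[symmetric])
    also have "\<dots> = (ennreal (1 / k) * ennreal k) * (\<integral>\<^sup>+x. g x \<partial>lborel)"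
      by (simp add: eq[OF that] k mult_ac)
    also have "\<dots> = (\<integral>\<^sup>+x. g x \<partial>lborel)" using k by (simp add: ennreal_mult'[symmetric])
    finally show ?thesis .
  qed
  then show ?thesis using k m by (auto simp: volume_factor_def intro!: exI[of _ "m / k"])
qed

lemma volume_factor_unique:
  fixes A :: "real^'n^'n"
  assumes A: "volume_factor A c" "volume_factor A c'"
  shows "c = c'"
proof -
  define F :: "real^'n \<Rightarrow> ennreal" where "F = indicator (ball 0 1)"
  have [measurable]: "F \<in> borel_measurable borel" by (auto simp: F_def intro!: borel_measurable_indicator)
  obtain m where m: "0 < m" "(\<integral>\<^sup>+x. F x \<partial>lborel) = ennreal m"
    using nn_integral_unit_ball unfolding F_def by blast
  let ?k = "\<integral>\<^sup>+x. F (A *v x) \<partial>lborel"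
  have c: "0 < c" "0 < c'" using A by (auto simp: volume_factor_def)
  have eq: "ennreal c * ?k = ennreal m" "ennreal c' * ?k = ennreal m"
    using A m by (auto simp: volume_factorD)
  have "?k \<noteq> \<infinity>" using eq(1) c by (auto simp: ennreal_mult_eq_top_iff ennreal_top_mult ennreal_mult_top)
  then obtain k where k: "0 \<le> k" "?k = ennreal k" by (metis ennreal_cases infinity_ennreal_def)
  have "c * k = m" "c' * k = m"
    using eq k c m by (simp_all add: ennreal_mult'[symmetric])
  then show ?thesis using m by (metis less_irrefl mult_cancel_right mult_zero_right)
qed

lemma volume_factor_mult:
  assumes A: "volume_factor A c" and B: "volume_factor B d"
  shows "volume_factor (A ** B) (c * d)"
  unfolding volume_factor_def
proof safe
  show "0 < c * d" using A B by (simp add: volume_factor_def)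
  fix g :: "real^'a \<Rightarrow> ennreal" assume [measurable]: "g \<in> borel_measurable borel"
  have "ennreal (c * d) * (\<integral>\<^sup>+x. g ((A ** B) *v x) \<partial>lborel)
      = ennreal c * (ennreal d * (\<integral>\<^sup>+x. g (A *v (B *v x)) \<partial>lborel))"
    using A by (simp add: volume_factor_def ennreal_mult' matrix_vector_mul_assoc mult.assoc)
  also have "\<dots> = (\<integral>\<^sup>+x. g x \<partial>lborel)"
    using volume_factorD[OF B, of "\<lambda>x. g (A *v x)"] volume_factorD[OF A, of g] by simp
  finally show "ennreal (c * d) * (\<integral>\<^sup>+x. g ((A ** B) *v x) \<partial>lborel) = (\<integral>\<^sup>+x. g x \<partial>lborel)" .
qed

lemma volume_factor_mat_1: "volume_factor (mat 1) 1"
  by (simp add: volume_factor_def)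

text \<open>The unit ball is its own preimage, so its volume satisfies
  \<open>c * m = m\<close>.\<close>

lemma volume_factor_isometry:
  fixes A :: "real^'n^'n"
  assumes A: "invertible A" and nrm: "\<And>x. norm (A *v x) = norm x"
  shows "volume_factor A 1"
proof -
  obtain c where c: "volume_factor A c" using volume_factor_exists[OF A] by blast
  define F :: "real^'n \<Rightarrow> ennreal" where "F = indicator (ball 0 1)"
  have [measurable]: "F \<in> borel_measurable borel" by (auto simp: F_def intro!: borel_measurable_indicator)
  obtain m where m: "0 < m" "(\<integral>\<^sup>+x. F x \<partial>lborel) = ennreal m"
    using nn_integral_unit_ball unfolding F_def by blast
  have "F (A *v x) = F x" for x by (simp add: F_def indicator_def nrm)
  then have "ennreal c * ennreal m = ennreal m" using volume_factorD[OF c, of F] m by simp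
  then have "c = 1" using m c by (simp add: volume_factor_def ennreal_mult'[symmetric])
  then show ?thesis using c by simp
qed

section \<open>Volume factors of elementary matrices and the determinant\<close>

lemma volume_factor_diagonal:
  fixes A :: "real^'n^'n"
  assumes diag: "\<And>i j. i \<noteq> j \<Longrightarrow> A $ i $ j = 0" and nz: "\<And>i. A $ i $ i \<noteq> 0"
  shows "volume_factor A \<bar>\<Prod>i\<in>UNIV. A $ i $ i\<bar>"
proof -
  define c where "c b = b \<bullet> (A *v b)" for b
  have Aax: "A *v axis i 1 = A $ i $ i *\<^sub>R axis i 1" for i
    using diag unfolding matrix_vector_mult_basis by (auto simp: vec_eq_iff column_def axis_def)
  have c: "c (axis i 1) = A $ i $ i" for i by (simp add: c_def Aax inner_axis_axis)
  have "A *v x = 0 + (\<Sum>j\<in>Basis. (c j * (x \<bullet> j)) *\<^sub>R j)" for x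
  proof -
    have "A *v x = A *v (\<Sum>j\<in>Basis. (x \<bullet> j) *\<^sub>R j)" by (simp add: euclidean_representation)
    also have "\<dots> = (\<Sum>j\<in>Basis. (x \<bullet> j) *\<^sub>R (A *v j))"
      by (simp add: linear_sum[OF matrix_vector_mul_linear] matrix_vector_mult_scaleR)
    also have "\<dots> = (\<Sum>j\<in>Basis. (c j * (x \<bullet> j)) *\<^sub>R j)"
      by (intro sum.cong) (auto simp: Basis_vec_def c Aax mult.commute)
    finally show ?thesis by simp
  qed
  then have T: "(\<lambda>x. 0 + (\<Sum>j\<in>Basis. (c j * (x \<bullet> j)) *\<^sub>R j)) = (*v) A" by (simp add: fun_eq_iff)
  have P: "(\<Prod>j\<in>Basis. \<bar>c j\<bar>) = \<bar>\<Prod>i\<in>UNIV. A $ i $ i\<bar>"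
  proof -
    have B: "Basis = range (\<lambda>i::'n. axis i (1::real))" by (auto simp: Basis_vec_def)
    have "inj (\<lambda>i::'n. axis i (1::real))" by (simp add: inj_on_def axis_eq_axis)
    then show ?thesis by (simp add: B prod.reindex c abs_prod)
  qed
  have nzc: "c j \<noteq> 0" if "j \<in> Basis" for j using that nz by (auto simp: Basis_vec_def c)
  have L: "lborel = density (distr lborel borel ((*v) A)) (\<lambda>_. ennreal \<bar>\<Prod>i\<in>UNIV. A $ i $ i\<bar>)"
    using lborel_affine_euclidean[of c 0, OF nzc] unfolding T P .
  show ?thesis
    unfolding volume_factor_def
  proof safe
    show "0 < \<bar>\<Prod>i\<in>UNIV. A $ i $ i\<bar>" using nz by simp
    fix g :: "real^'n \<Rightarrow> ennreal" assume [measurable]: "g \<in> borel_measurable borel"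
    show "ennreal \<bar>\<Prod>i\<in>UNIV. A $ i $ i\<bar> * (\<integral>\<^sup>+x. g (A *v x) \<partial>lborel) = (\<integral>\<^sup>+x. g x \<partial>lborel)"
      by (subst (2) L) (simp add: nn_integral_density nn_integral_distr nn_integral_cmult)
  qed
qed

definition shear_matrix :: "'n \<Rightarrow> 'n \<Rightarrow> real \<Rightarrow> real^'n^'n" where
  "shear_matrix m n c = (\<chi> i j. of_bool (i = j) + (if i = m \<and> j = n then c else 0))"

lemma shear_matrix_vector:
  fixes x :: "real^'n"
  shows "shear_matrix m n c *v x = (\<chi> i. x $ i + (if i = m then c * x $ n else 0))"
proof -
  have "(\<Sum>j\<in>UNIV. (of_bool (i = j) + (if i = m \<and> j = n then c else 0)) * x $ j)
      = (\<Sum>j\<in>UNIV. (if j = i then x $ j else 0)) + (\<Sum>j\<in>UNIV. if j = n then (if i = m then c * x $ n else 0) else 0)" for i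
    by (subst sum.distrib[symmetric]) (auto intro!: sum.cong simp: algebra_simps)
  then show ?thesis
    by (simp add: shear_matrix_def matrix_vector_mult_def vec_eq_iff)
qed

text \<open>The shears with coefficients \<open>c\<close> and \<open>-c\<close> are mutually inverse and conjugate by a reflection,
  so their common volume factor has square one.\<close>

lemma volume_factor_shear:
  fixes m n :: "'n::finite"
  assumes "m \<noteq> n"
  shows "volume_factor (shear_matrix m n c) 1"
proof -
  define D :: "real^'n^'n" where "D = (\<chi> i j. if i = j then (if i = m then -1 else 1) else 0)"
  have DD: "D *v x = (\<chi> i. if i = m then - x $ i else x $ i)" for x
  proof -
    have "(\<Sum>j\<in>UNIV. (if i = j then (if i = m then -1 else 1) else 0) * x $ j)
      = (\<Sum>j\<in>UNIV. if j = i then (if i = m then - x $ i else x $ i) else 0)" for i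
      by (intro sum.cong) auto
    then show ?thesis by (simp add: D_def matrix_vector_mult_def vec_eq_iff)
  qed
  have "volume_factor D \<bar>\<Prod>i\<in>UNIV. D $ i $ i\<bar>"
    by (rule volume_factor_diagonal) (auto simp: D_def)
  then have D: "volume_factor D 1" by (simp add: D_def abs_prod)
  have inv: "shear_matrix m n c ** shear_matrix m n (-c) = mat 1" 
    using assms by (simp add: matrix_eq matrix_vector_mul_assoc[symmetric] shear_matrix_vector vec_eq_iff)
  have conj: "D ** (shear_matrix m n c ** D) = shear_matrix m n (-c)"
    using assms by (simp add: matrix_eq matrix_vector_mul_assoc[symmetric] shear_matrix_vector DD vec_eq_iff)
  have "invertible (shear_matrix m n c)" using inv invertible_right_inverse by blast
  then obtain k where k: "volume_factor (shear_matrix m n c) k" using volume_factor_exists by blast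
  have "volume_factor (shear_matrix m n (-c)) (1 * (k * 1))"
    unfolding conj[symmetric] by (intro volume_factor_mult D k)
  from volume_factor_mult[OF k this] have "k * k = 1"
    unfolding inv using volume_factor_unique[OF _ volume_factor_mat_1] by simp
  then have "k = 1" using k by (simp add: volume_factor_def) (metis abs_of_pos abs_mult_self_eq real_sqrt_abs2 real_sqrt_one)
  then show ?thesis using k by simp
qed

lemma det_shear_matrix:
  fixes m n :: "'n::finite"
  assumes "m \<noteq> n"
  shows "det (shear_matrix m n c) = 1"
proof -
  have "shear_matrix m n c = (\<chi> k. if k = m then row m (mat 1) + c *s row n (mat 1) else row k (mat 1))"
    by (auto simp: shear_matrix_def vec_eq_iff row_def mat_def)
  then show ?thesis using det_row_operation[OF assms, of "mat 1" c] by simp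
qed

theorem volume_factor_det:
  fixes A :: "real^'n^'n"
  assumes "invertible A"
  shows "volume_factor A \<bar>det A\<bar>"
proof -
  \<comment> \<open>Invertibility is carried inside the induction because the generators include
    matrices with a zero row, where the claim is vacuous. For a product, the determinant passes
    invertibility to both factors.\<close>
  have "invertible A \<longrightarrow> volume_factor A \<bar>det A\<bar>"
  proof (rule induct_matrix_elementary_alt)
    fix A B :: "real^'n^'n"
    assume "invertible A \<longrightarrow> volume_factor A \<bar>det A\<bar>" "invertible B \<longrightarrow> volume_factor B \<bar>det B\<bar>"
    then show "invertible (A ** B) \<longrightarrow> volume_factor (A ** B) \<bar>det (A ** B)\<bar>"
      using volume_factor_mult[of A _ B] by (simp add: invertible_det_nz det_mul abs_mult)
  next
    fix A :: "real^'n^'n" and i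
    assume "row i A = 0"
    then show "invertible A \<longrightarrow> volume_factor A \<bar>det A\<bar>"
      by (simp add: invertible_det_nz det_zero_row)
  next
    fix A :: "real^'n^'n"
    assume diag: "\<And>i j. i \<noteq> j \<Longrightarrow> A $ i $ j = 0"
    then show "invertible A \<longrightarrow> volume_factor A \<bar>det A\<bar>"
      by (auto simp: invertible_det_nz det_diagonal volume_factor_diagonal)
  next
    fix m n :: 'n assume "m \<noteq> n"
    let ?p = "Transposition.transpose m n"
    let ?A = "\<chi> i j. mat 1 $ i $ ?p j :: real^'n^'n"
    have p: "?p permutes UNIV" by (simp add: permutes_swap_id)
    have d: "\<bar>det ?A\<bar> = 1"
      by (subst det_permute_columns[OF p]) (simp add: sign_def)
    have "?A *v x = (\<chi> i. x $ ?p i)" for x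
    proof -
      have "(\<Sum>j\<in>UNIV. (mat 1 :: real^'n^'n) $ i $ ?p j * x $ j) = (\<Sum>j\<in>UNIV. if j = ?p i then x $ j else 0)" for i
        by (intro sum.cong) (auto simp: mat_def)
      then show ?thesis by (simp add: matrix_vector_mult_def vec_eq_iff)
    qed
    then have "(norm (?A *v x))\<^sup>2 = (norm x)\<^sup>2" for x
      using sum.permute[OF p, of "\<lambda>i. (x $ i)\<^sup>2"]
      by (simp add: norm_vec_def L2_set_def sum_nonneg o_def)
    then show "invertible ?A \<longrightarrow> volume_factor ?A \<bar>det ?A\<bar>"
      unfolding d by (auto intro!: volume_factor_isometry)
  next
    fix m n :: 'n assume mn: "m \<noteq> n"
    have "(\<chi> i j. of_bool (i = m \<and> j = n \<or> i = j)) = shear_matrix m n 1"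
      using mn by (auto simp: shear_matrix_def vec_eq_iff)
    then show "invertible (\<chi> i j. of_bool (i = m \<and> j = n \<or> i = j) :: real^'n^'n) \<longrightarrow>
        volume_factor (\<chi> i j. of_bool (i = m \<and> j = n \<or> i = j)) \<bar>det (\<chi> i j. of_bool (i = m \<and> j = n \<or> i = j) :: real^'n^'n)\<bar>"
      using mn by (simp add: det_shear_matrix volume_factor_shear)
  qed
  then show ?thesis using assms by blast
qed

lemma nn_integral_lborel_affine:
  fixes A :: "real^'n^'n"
  assumes "invertible A" and [measurable]: "g \<in> borel_measurable borel"
  shows "(\<integral>\<^sup>+x. ennreal \<bar>det A\<bar> * g (v + A *v (x - m)) \<partial>lborel) = (\<integral>\<^sup>+x. g x \<partial>lborel)"
proof -
  have "(\<integral>\<^sup>+x. ennreal \<bar>det A\<bar> * g (v + A *v (x - m)) \<partial>lborel)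
      = ennreal \<bar>det A\<bar> * (\<integral>\<^sup>+x. g (v + A *v (- m + x)) \<partial>lborel)"
    by (simp add: nn_integral_cmult)
  also have "\<dots> = ennreal \<bar>det A\<bar> * (\<integral>\<^sup>+x. g (v + A *v x) \<partial>lborel)"
    by (subst nn_integral_lborel_translate[where g = "\<lambda>x. g (v + A *v x)"]) simp_all
  also have "\<dots> = (\<integral>\<^sup>+x. g (v + x) \<partial>lborel)"
    using volume_factorD[OF volume_factor_det[OF assms(1)], of "\<lambda>x. g (v + x)"] by simp
  finally show ?thesis by (simp add: nn_integral_lborel_translate)
qed


section \<open>Gaussian measures\<close>

lemma matrix_inv_mat_1: "matrix_inv (mat 1 :: real^'n^'n) = mat 1"
  by (rule matrix_inv_unique) simp

lemma sets_gaussian [simp, measurable_cong]: "sets (gaussian m \<Sigma>) = sets borel"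
  by (simp add: gaussian_def)

lemma space_gaussian [simp]: "space (gaussian m \<Sigma>) = UNIV"
  by (simp add: gaussian_def)

lemma distr_gaussian_affine:
  fixes A \<Sigma> :: "real^'n^'n"
  assumes \<Sigma>: "positive_definite \<Sigma>" and A: "invertible A"
  shows "distr (gaussian m \<Sigma>) borel (\<lambda>x. v + A *v (x - m)) = gaussian v (A ** \<Sigma> ** transpose A)"
proof (rule measure_eqI)
  let ?T = "\<lambda>x. v + A *v (x - m)"
  let ?\<Sigma>' = "A ** \<Sigma> ** transpose A"
  let ?c = "(2 * pi) ^ CARD('n)"
  define f where "f x = exp (- ((x - m) \<bullet> (matrix_inv \<Sigma> *v (x - m))) / 2) / sqrt (?c * det \<Sigma>)" for x
  define F where "F x = exp (- ((x - v) \<bullet> (matrix_inv ?\<Sigma>' *v (x - v))) / 2) / sqrt (?c * det ?\<Sigma>')" for x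
  have [measurable]: "f \<in> borel_measurable borel" unfolding f_def by measurable
  have [measurable]: "F \<in> borel_measurable borel" unfolding F_def by measurable
  note iS = positive_definite_invertible[OF \<Sigma>]
  have dA: "det A \<noteq> 0" using A by (simp add: invertible_det_nz)
  then have iAt: "invertible (transpose A)" by (simp add: invertible_det_nz)
  have iS': "invertible ?\<Sigma>'" using A iS iAt by (simp add: invertible_mult)
  have quad: "(A *v z) \<bullet> (matrix_inv ?\<Sigma>' *v (A *v z)) = z \<bullet> (matrix_inv \<Sigma> *v z)" for z
  proof -
    \<comment> \<open>\<open>y\<close> solves \<open>\<Sigma>' y = A z\<close> one factor at a time,
      which spares a formula for the inverse of the triple product.\<close>
    define y where "y = matrix_inv (transpose A) *v (matrix_inv \<Sigma> *v z)"
    have Ay: "transpose A *v y = matrix_inv \<Sigma> *v z" unfolding y_def by (rule matrix_inv_vector(1)[OF iAt])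
    have "?\<Sigma>' *v y = A *v z"
      by (simp only: matrix_vector_mul_assoc[symmetric] Ay matrix_inv_vector[OF iS])
    then have "matrix_inv ?\<Sigma>' *v (A *v z) = y" by (metis iS' matrix_inv_vector(2))
    then have "(A *v z) \<bullet> (matrix_inv ?\<Sigma>' *v (A *v z)) = z \<bullet> (transpose A *v y)"
      by (metis dot_lmul_matrix inner_commute transpose_matrix_vector)
    then show ?thesis by (simp only: Ay)
  qed
  \<comment> \<open>The normalising constants differ by exactly the Jacobian that
    \<open>nn_integral_lborel_affine\<close> absorbs.\<close>
  have "sqrt (?c * det ?\<Sigma>') = \<bar>det A\<bar> * sqrt (?c * det \<Sigma>)"
    by (simp add: det_mul det_transpose real_sqrt_mult)
  then have fF: "f x = \<bar>det A\<bar> * F (?T x)" for x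
    using dA by (simp add: f_def F_def quad)
  fix S assume "S \<in> sets (distr (gaussian m \<Sigma>) borel ?T)"
  then have [measurable]: "S \<in> sets borel" by simp
  have F0: "0 \<le> F x" for x
  proof -
    have "det ?\<Sigma>' = (det A)\<^sup>2 * det \<Sigma>" by (simp add: det_mul det_transpose power2_eq_square)
    then have "0 \<le> det ?\<Sigma>'" using det_positive_definite_pos[OF \<Sigma>] by simp
    then show ?thesis by (simp add: F_def)
  qed
  have "emeasure (distr (gaussian m \<Sigma>) borel ?T) S
      = (\<integral>\<^sup>+x. ennreal (f x) * indicator S (?T x) \<partial>lborel)"
  proof -
    have "gaussian m \<Sigma> = density lborel (\<lambda>x. ennreal (f x))" by (simp add: gaussian_def f_def)
    moreover have "?T -` S \<in> sets borel" using measurable_sets_borel[of ?T borel S] by simp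
    ultimately show ?thesis
      by (simp add: emeasure_distr emeasure_density indicator_vimage o_def)
  qed
  also have "\<dots> = (\<integral>\<^sup>+x. ennreal \<bar>det A\<bar> * (ennreal (F (?T x)) * indicator S (?T x)) \<partial>lborel)"
    by (simp add: fF ennreal_mult F0 mult.assoc)
  also have "\<dots> = (\<integral>\<^sup>+x. ennreal (F x) * indicator S x \<partial>lborel)"
    by (rule nn_integral_lborel_affine[OF A, where g = "\<lambda>x. ennreal (F x) * indicator S x"]) simp
  also have "\<dots> = emeasure (gaussian v ?\<Sigma>') S"
  proof -
    have "gaussian v ?\<Sigma>' = density lborel (\<lambda>x. ennreal (F x))" by (simp add: gaussian_def F_def)
    then show ?thesis by (simp add: emeasure_density)
  qed
  finally show "emeasure (distr (gaussian m \<Sigma>) borel ?T) S = emeasure (gaussian v ?\<Sigma>') S" .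
qed simp

lemma nn_integral_normal_density: "0 < s \<Longrightarrow> (\<integral>\<^sup>+x. ennreal (normal_density m s x) \<partial>lborel) = 1"
  using prob_space.emeasure_space_1[OF prob_space_normal_density[of s m]]
  by (simp add: emeasure_density)

section \<open>Total mass and one-dimensional projections of Gaussians\<close>

lemma standard_gaussian_coordinate:
  fixes k :: "'n::finite"
  assumes [measurable]: "S \<in> sets borel"
  shows "emeasure (gaussian 0 (mat 1 :: real^'n^'n)) {x. x $ k \<in> S} =
    (\<integral>\<^sup>+t. ennreal (std_normal_density t) * indicator S t \<partial>lborel)"
proof -
  let ?e = "axis k (1::real)"
  \<comment> \<open>The density is a product over the basis. The indicator is attached to the factor
    of \<open>axis k 1\<close> alone, so every other factor integrates to one.\<close>
  define g where "g b t = (std_normal_density t * (if b = ?e then indicator S t else 1))"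
    for b :: "real^'n" and t :: real
  have [measurable]: "g b \<in> borel_measurable borel" for b
    unfolding g_def by measurable
  have g0: "0 \<le> g b t" for b t by (simp add: g_def)
  have e: "?e \<in> Basis" by simp
  have card: "card (Basis :: (real^'n) set) = CARD('n)" by simp
  have "exp (- (x \<bullet> x) / 2) / sqrt ((2 * pi) ^ CARD('n)) * indicator {x. x $ k \<in> S} x
      = (\<Prod>b\<in>Basis. g b (x \<bullet> b))" for x :: "real^'n"
  proof -
    have "(\<Prod>b\<in>Basis. g b (x \<bullet> b)) = (\<Prod>b\<in>Basis. std_normal_density (x \<bullet> b)) *
        (\<Prod>b\<in>Basis. if b = ?e then indicator S (x \<bullet> b) else 1)"
      by (simp add: g_def prod.distrib)
    also have "(\<Prod>b\<in>Basis. if b = ?e then indicator S (x \<bullet> b) else 1) = (indicator {x. x $ k \<in> S} x :: real)"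
      using e by (simp add: prod.delta inner_axis indicator_def)
    also have "(\<Prod>b\<in>Basis. std_normal_density (x \<bullet> b)) = exp (- (x \<bullet> x) / 2) / sqrt ((2 * pi) ^ CARD('n))"
    proof -
      have "exp (- (x \<bullet> x) / 2) = (\<Prod>b\<in>Basis. exp (- (x \<bullet> b)\<^sup>2 / 2))"
        by (subst euclidean_inner)
          (simp add: exp_sum[symmetric] sum_negf sum_divide_distrib power2_eq_square)
      moreover have "(\<Prod>b\<in>Basis. std_normal_density (x \<bullet> b))
          = (1 / sqrt (2 * pi)) ^ CARD('n) * (\<Prod>b\<in>Basis. exp (- (x \<bullet> b)\<^sup>2 / 2))"
        unfolding std_normal_density_def prod.distrib prod_constant card ..
      moreover have "(1 / sqrt (2 * pi)) ^ CARD('n) = 1 / sqrt ((2 * pi) ^ CARD('n))"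
        by (simp only: power_one_over real_sqrt_power)
      ultimately show ?thesis by simp
    qed
    finally show ?thesis ..
  qed
  note eq = this
  have "emeasure (gaussian 0 (mat 1 :: real^'n^'n)) {x. x $ k \<in> S}
      = (\<integral>\<^sup>+x. ennreal (exp (- (x \<bullet> x) / 2) / sqrt ((2 * pi) ^ CARD('n))) * indicator {x. x $ k \<in> S} x \<partial>(lborel :: (real^'n) measure))"
    by (simp add: gaussian_def matrix_inv_mat_1 emeasure_density)
  also have "\<dots> = (\<integral>\<^sup>+x. (\<Prod>b\<in>Basis. ennreal (g b (x \<bullet> b))) \<partial>lborel)"
    by (intro nn_integral_cong)
      (simp add: prod_ennreal g0 eq[symmetric] ennreal_mult''[symmetric] ennreal_indicator[symmetric])
  also have "\<dots> = (\<Prod>b\<in>Basis. \<integral>\<^sup>+t. ennreal (g b t) \<partial>lborel)"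
    by (rule nn_integral_lborel_prod) simp_all
  also have "\<dots> = (\<Prod>b\<in>Basis. if b = ?e then (\<integral>\<^sup>+t. ennreal (std_normal_density t) * indicator S t \<partial>lborel) else 1)"
    by (intro prod.cong refl)
      (auto simp: g_def ennreal_mult' ennreal_indicator nn_integral_normal_density)
  also have "\<dots> = (\<integral>\<^sup>+t. ennreal (std_normal_density t) * indicator S t \<partial>lborel)"
    using e by (simp add: prod.delta)
  finally show ?thesis .
qed

lemma gaussian_eq_distr_standard:
  fixes \<Sigma> :: "real^'n^'n"
  assumes \<Sigma>: "positive_definite \<Sigma>"
  shows "gaussian m \<Sigma> = distr (gaussian 0 (mat 1)) borel (\<lambda>x. m + matrix_sqrt \<Sigma> *v x)"
proof -
  note pd = positive_definite_sqrt[OF \<Sigma>]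
  have "matrix_sqrt \<Sigma> ** mat 1 ** transpose (matrix_sqrt \<Sigma>) = \<Sigma>"
    using matrix_sqrt(2)[OF positive_definite_imp_semidefinite[OF \<Sigma>]] pd
    by (simp add: positive_definite_symmetric)
  then show ?thesis
    using distr_gaussian_affine[OF positive_definite_mat_1 positive_definite_invertible[OF pd], of 0 m]
    by simp
qed

lemma prob_space_gaussian:
  fixes \<Sigma> :: "real^'n^'n"
  assumes \<Sigma>: "positive_definite \<Sigma>"
  shows "prob_space (gaussian m \<Sigma>)"
proof -
  \<comment> \<open>With the whole line as test set, the coordinate law computes the total
    mass.\<close>
  have "emeasure (gaussian 0 (mat 1 :: real^'n^'n)) UNIV = 1"
    using standard_gaussian_coordinate[of UNIV undefined] nn_integral_normal_density[of 1 0] by simp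
  then have "prob_space (gaussian 0 (mat 1 :: real^'n^'n))"
    by (intro prob_spaceI) simp
  then show ?thesis
    unfolding gaussian_eq_distr_standard[OF \<Sigma>] by (rule prob_space.prob_space_distr) simp
qed

text \<open>The standard Gaussian is invariant under rotations. Rotating the direction of
  \<open>w\<close> to a coordinate axis reduces the projection to a single coordinate, and any
  coordinate serves.\<close>

lemma distributed_standard_gaussian_inner:
  fixes w :: "real^'n"
  assumes "w \<noteq> 0"
  shows "distributed (gaussian 0 (mat 1 :: real^'n^'n)) lborel (\<lambda>x. x \<bullet> w) (normal_density 0 (norm w))"
proof -
  let ?G = "gaussian 0 (mat 1 :: real^'n^'n)"
  interpret prob_space ?G by (rule prob_space_gaussian[OF positive_definite_mat_1])
  define k :: 'n where "k = undefined"
  have "norm (w /\<^sub>R norm w) = 1" using assms by simp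
  then obtain U where U: "orthogonal_matrix U" "U *v axis k 1 = w /\<^sub>R norm w"
    by (metis orthogonal_matrix_exists_basis)
  have UU: "transpose (transpose U) = U" "transpose U ** U = mat 1" "U ** transpose U = mat 1"
    using U(1) by (simp_all add: orthogonal_matrix_def)
  have "invertible (transpose U)" using UU unfolding invertible_def by blast
  from distr_gaussian_affine[OF positive_definite_mat_1 this, of 0 0]
  have rot: "distr ?G borel (\<lambda>x. transpose U *v x) = ?G" by (simp add: UU)
  have coord: "(transpose U *v x) $ k = x \<bullet> w / norm w" for x
  proof -
    have "(transpose U *v x) $ k = (transpose U *v x) \<bullet> axis k 1" by (simp add: inner_axis)
    also have "\<dots> = x \<bullet> (U *v axis k 1)" by (metis dot_lmul_matrix transpose_matrix_vector UU(1))
    finally show ?thesis by (simp add: U(2) divide_inverse mult.commute)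
  qed
  have "distributed ?G lborel (\<lambda>x. x \<bullet> w / norm w) std_normal_density"
  proof (subst distributed_def, intro conjI measure_eqI)
    fix S :: "real set" assume "S \<in> sets (distr ?G lborel (\<lambda>x. x \<bullet> w / norm w))"
    then have [measurable]: "S \<in> sets borel" by simp
    have "emeasure (distr ?G lborel (\<lambda>x. x \<bullet> w / norm w)) S = emeasure ?G {x. (transpose U *v x) $ k \<in> S}"
      unfolding coord by (simp add: emeasure_distr vimage_def)
    also have "\<dots> = emeasure (distr ?G borel (\<lambda>x. transpose U *v x)) {x. x $ k \<in> S}"
      by (subst emeasure_distr) (simp_all add: vimage_def)
    also have "\<dots> = emeasure (density lborel (\<lambda>x. ennreal (std_normal_density x))) S"
      unfolding rot by (simp add: standard_gaussian_coordinate emeasure_density)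
    finally show "emeasure (distr ?G lborel (\<lambda>x. x \<bullet> w / norm w)) S
      = emeasure (density lborel (\<lambda>x. ennreal (std_normal_density x))) S" .
  qed simp_all
  from normal_density_affine[OF this, of "norm w" 0] show ?thesis using assms by simp
qed

lemma distributed_gaussian_inner:
  fixes w :: "real^'n"
  assumes \<Sigma>: "positive_definite \<Sigma>" and w: "w \<noteq> 0"
  shows "\<exists>s>0. distributed (gaussian m \<Sigma>) lborel (\<lambda>x. (x - m) \<bullet> w) (normal_density 0 s)"
proof (intro exI conjI)
  let ?R = "matrix_sqrt \<Sigma>"
  note pd = positive_definite_sqrt[OF \<Sigma>]
  have nz: "?R *v w \<noteq> 0"
    by (metis matrix_inv_vector(2) matrix_vector_mult_0_right pd positive_definite_invertible w)
  then show "0 < norm (?R *v w)" by simp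
  have "(?R *v x) \<bullet> w = x \<bullet> (?R *v w)" for x
    by (rule symmetric_matrix_inner[OF positive_definite_symmetric[OF pd], symmetric])
  then show "distributed (gaussian m \<Sigma>) lborel (\<lambda>x. (x - m) \<bullet> w) (normal_density 0 (norm (?R *v w)))"
    using distributed_standard_gaussian_inner[OF nz]
    unfolding gaussian_eq_distr_standard[OF \<Sigma>] by (simp add: distributed_def distr_distr o_def)
qed

text \<open>Every linear functional of a point on the graph is an affine functional of
  \<open>x\<close> alone, with direction \<open>w' = fst w + L\<^sup>T (snd w)\<close>. The
  directions with \<open>w' = 0\<close> are those in which the joint law degenerates to a point
  mass.\<close>

lemma is_gaussian_affine_graph:
  fixes L :: "real^'n^'n"
  assumes \<Sigma>: "positive_definite \<Sigma>"
  shows "is_gaussian (distr (gaussian u \<Sigma>) borel (\<lambda>x. (x, v + L *v (x - u))))"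
  unfolding is_gaussian_def
proof (intro conjI allI)
  let ?G = "gaussian u \<Sigma>"
  let ?\<pi> = "distr ?G borel (\<lambda>x. (x, v + L *v (x - u)))"
  interpret prob_space ?G by (rule prob_space_gaussian[OF \<Sigma>])
  have [measurable]: "(\<lambda>x. (x, v + L *v (x - u))) \<in> borel_measurable ?G"
    by (simp add: borel_prod[symmetric])
  fix w :: "(real^'n) \<times> (real^'n)"
  define a where "a = u \<bullet> fst w + v \<bullet> snd w"
  define w' where "w' = fst w + transpose L *v snd w"
  \<comment> \<open>The factor 1 is kept so that the expression has the shape required by
    \<open>normal_density_affine\<close>.\<close>
  have "(x, v + L *v (x - u)) \<bullet> w = a + 1 * ((x - u) \<bullet> w')" for x
  proof -
    have "(L *v (x - u)) \<bullet> snd w = (x - u) \<bullet> (transpose L *v snd w)"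
      by (metis dot_lmul_matrix inner_commute transpose_matrix_vector)
    then show ?thesis by (simp add: a_def w'_def inner_prod_def inner_simps)
  qed
  then have eq: "distr ?\<pi> borel (\<lambda>x. x \<bullet> w) = distr ?G borel (\<lambda>x. a + 1 * ((x - u) \<bullet> w'))"
    by (simp add: distr_distr o_def)
  show "(\<exists>m. distr ?\<pi> borel (\<lambda>x. x \<bullet> w) = return borel m) \<or>
    (\<exists>m s. 0 < s \<and> distr ?\<pi> borel (\<lambda>x. x \<bullet> w) = density lborel (\<lambda>t. ennreal (normal_density m s t)))"
  proof (cases "w' = 0")
    case True
    have "distr ?G borel (\<lambda>x. a) = return borel a"
      by (rule distr_const) simp
    then show ?thesis unfolding eq using True by auto
  next
    case False
    obtain s where s: "0 < s" "distributed ?G lborel (\<lambda>x. (x - u) \<bullet> w') (normal_density 0 s)"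
      using distributed_gaussian_inner[OF \<Sigma> False] by blast
    have "distributed ?G lborel (\<lambda>x. a + 1 * ((x - u) \<bullet> w')) (normal_density (a + 1 * 0) (\<bar>1\<bar> * s))"
      using s by (intro normal_density_affine) auto
    then have "distr ?G lborel (\<lambda>x. a + 1 * ((x - u) \<bullet> w')) = density lborel (\<lambda>t. ennreal (normal_density a s t))"
      by (simp add: distributed_def)
    moreover have "distr ?G lborel (\<lambda>x. a + 1 * ((x - u) \<bullet> w')) = distr ?G borel (\<lambda>x. a + 1 * ((x - u) \<bullet> w'))"
      by (rule distr_cong) simp_all
    ultimately show ?thesis unfolding eq using s(1) by metis
  qed
qed simp

text \<open>The decay \<open>exp (- c |x - m|\<^sup>2 / 2)\<close> from coercivity of the precision
  has room to absorb a small growing factor. What remains is dominated by a multiple of the wider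
  Gaussian with covariance \<open>(2 / c) I\<close>, whose mass is known.\<close>

lemma gaussian_exp_moment:
  fixes \<Sigma> :: "real^'n^'n"
  assumes \<Sigma>: "positive_definite \<Sigma>"
  shows "\<exists>e>0. integrable (gaussian m \<Sigma>) (\<lambda>x. exp (e * (norm x)\<^sup>2))"
proof -
  obtain c where c: "0 < c" "\<And>x. c * (norm x)\<^sup>2 \<le> x \<bullet> (matrix_inv \<Sigma> *v x)"
    using positive_definite_coercive[OF positive_definite_matrix_inv[OF \<Sigma>]] by blast
  define \<Sigma>' :: "real^'n^'n" where "\<Sigma>' = (2 / c) *\<^sub>R mat 1"
  have pd': "positive_definite \<Sigma>'"
    unfolding \<Sigma>'_def using c by (intro positive_definite_scaleR positive_definite_mat_1) simp
  have inv': "matrix_inv \<Sigma>' = (c / 2) *\<^sub>R mat 1"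
    by (rule matrix_inv_unique) (use c in \<open>simp add: \<Sigma>'_def matrix_eq matrix_vector_mul_assoc[symmetric]
        scaleR_matrix_vector_assoc[symmetric]\<close>)
  interpret G': prob_space "gaussian m \<Sigma>'" by (rule prob_space_gaussian[OF pd'])
  \<comment> \<open>The bound of \<open>|x|\<^sup>2\<close> by
    \<open>2 |x - m|\<^sup>2 + 2 |m|\<^sup>2\<close> doubles the exponent, so \<open>c / 8\<close>
    uses up \<open>c / 4\<close>, half of the available decay rate \<open>c / 2\<close>.\<close>
  define e where "e = c / 8"
  define D where "D = sqrt ((2 * pi) ^ CARD('n) * det \<Sigma>)"
  define D' where "D' = sqrt ((2 * pi) ^ CARD('n) * det \<Sigma>')"
  have D: "0 < D" "0 < D'"
    using det_positive_definite_pos[OF \<Sigma>] det_positive_definite_pos[OF pd'] by (simp_all add: D_def D'_def)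
  define K where "K = exp (c / 4 * (norm m)\<^sup>2) * D' / D"
  have K: "0 \<le> K" using D by (simp add: K_def)
  have bound: "exp (- ((x - m) \<bullet> (matrix_inv \<Sigma> *v (x - m))) / 2) / D * exp (e * (norm x)\<^sup>2)
      \<le> K * (exp (- ((x - m) \<bullet> (matrix_inv \<Sigma>' *v (x - m))) / 2) / D')" for x
  proof -
    have "(norm x)\<^sup>2 \<le> (norm (x - m) + norm m)\<^sup>2"
      by (rule power_mono) (use norm_triangle_ineq[of "x - m" m] in simp_all)
    also have "\<dots> \<le> 2 * (norm (x - m))\<^sup>2 + 2 * (norm m)\<^sup>2"
      using sum_squares_bound[of "norm (x - m)" "norm m"] by (simp add: power2_sum)
    finally have "e * (norm x)\<^sup>2 \<le> c / 4 * (norm (x - m))\<^sup>2 + c / 4 * (norm m)\<^sup>2"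
      using mult_left_mono[of _ _ e] c by (fastforce simp: e_def distrib_left)
    moreover have "(x - m) \<bullet> (matrix_inv \<Sigma>' *v (x - m)) = c / 2 * (norm (x - m))\<^sup>2"
      by (simp add: inv' scaleR_matrix_vector_assoc[symmetric] dot_square_norm)
    ultimately have "- ((x - m) \<bullet> (matrix_inv \<Sigma> *v (x - m))) / 2 + e * (norm x)\<^sup>2
      \<le> c / 4 * (norm m)\<^sup>2 + (- ((x - m) \<bullet> (matrix_inv \<Sigma>' *v (x - m))) / 2)"
      using c(2)[of "x - m"] by linarith
    then have "exp (- ((x - m) \<bullet> (matrix_inv \<Sigma> *v (x - m))) / 2) * exp (e * (norm x)\<^sup>2)
      \<le> exp (c / 4 * (norm m)\<^sup>2) * exp (- ((x - m) \<bullet> (matrix_inv \<Sigma>' *v (x - m))) / 2)"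
      by (simp only: exp_add[symmetric] exp_le_cancel_iff)
    then show ?thesis using D by (simp add: K_def divide_right_mono)
  qed
  have "(\<integral>\<^sup>+x. ennreal (exp (e * (norm x)\<^sup>2)) \<partial>gaussian m \<Sigma>)
      = (\<integral>\<^sup>+x. ennreal (exp (- ((x - m) \<bullet> (matrix_inv \<Sigma> *v (x - m))) / 2) / D * exp (e * (norm x)\<^sup>2)) \<partial>lborel)"
    by (simp add: gaussian_def D_def nn_integral_density ennreal_mult''[symmetric])
  also have "\<dots> \<le> (\<integral>\<^sup>+x. ennreal K * ennreal (exp (- ((x - m) \<bullet> (matrix_inv \<Sigma>' *v (x - m))) / 2) / D') \<partial>lborel)"
    using bound by (intro nn_integral_mono) (simp add: ennreal_mult'[OF K, symmetric] ennreal_leI)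
  also have "\<dots> = ennreal K * emeasure (gaussian m \<Sigma>') UNIV"
    by (simp add: nn_integral_cmult gaussian_def D'_def emeasure_density)
  also have "\<dots> < \<infinity>" using G'.emeasure_space_1 by simp
  finally have "integrable (gaussian m \<Sigma>) (\<lambda>x. exp (e * (norm x)\<^sup>2))"
    by (intro integrableI_nonneg) simp_all
  then show ?thesis using c by (intro exI[of _ e]) (simp add: e_def)
qed

section \<open>Duality for the divergence and for unbalanced transport\<close>

text \<open>For \<open>r > 0\<close> and \<open>s = exp (- t) / r\<close> the gap between the two
  sides is \<open>r (s - 1 - ln s)\<close>, so both parts reduce to \<open>ln s \<le> s - 1\<close>
  and its equality case. At \<open>r = 0\<close> the inequality is strict.\<close>

lemma KL_integrand_ge:
  fixes r t :: real
  assumes r: "0 \<le> r"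
  shows "1 - exp (- t) \<le> (r * ln r - r + 1) + r * t"
    and "1 - exp (- t) = (r * ln r - r + 1) + r * t \<Longrightarrow> r = exp (- t)"
proof -
  define s where "s = exp (- t) / r"
  have id: "(r * ln r - r + 1) + r * t - (1 - exp (- t)) = r * (s - 1 - ln s)" and s: "0 < s" if "0 < r"
    using that by (simp_all add: s_def ln_div field_simps)
  show "1 - exp (- t) \<le> (r * ln r - r + 1) + r * t"
  proof (cases "r = 0")
    case False
    then have "0 < r" using r by simp
    moreover have "0 \<le> s - 1 - ln s" using ln_le_minus_one[OF s] \<open>0 < r\<close> by simp
    ultimately have "0 \<le> r * (s - 1 - ln s)" by simp
    then show ?thesis using id[OF \<open>0 < r\<close>] by linarith
  qed simp
  assume eq: "1 - exp (- t) = (r * ln r - r + 1) + r * t"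
  show "r = exp (- t)"
  proof (cases "r = 0")
    case True
    then show ?thesis using eq by simp
  next
    case False
    then have "0 < r" using r by simp
    then have "ln s = s - 1" using id[OF \<open>0 < r\<close>] eq by simp
    then have "s = 1" using ln_eq_minus_one[OF s] \<open>0 < r\<close> by simp
    then show ?thesis using \<open>0 < r\<close> by (simp add: s_def)
  qed
qed

lemma KL_integrand_nonneg: "0 \<le> r \<Longrightarrow> 0 \<le> r * ln r - r + (1::real)"
  using KL_integrand_ge(1)[of r 0] by simp

lemma KL_density_eq:
  fixes r :: "'a \<Rightarrow> real"
  assumes "finite_measure \<eta>" and [measurable]: "r \<in> borel_measurable \<eta>" and r: "\<And>x. 0 \<le> r x"
  shows "KL (density \<eta> (\<lambda>x. ennreal (r x))) \<eta> = (\<integral>\<^sup>+x. ennreal (r x * ln (r x) - r x + 1) \<partial>\<eta>)"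
proof -
  interpret finite_measure \<eta> by fact
  have "AE x in \<eta>. ennreal (r x) = RN_deriv \<eta> (density \<eta> (\<lambda>x. ennreal (r x))) x"
    by (rule RN_deriv_unique) simp_all
  then have "AE x in \<eta>. enn2real (RN_deriv \<eta> (density \<eta> (\<lambda>x. ennreal (r x))) x) = r x"
    by eventually_elim (metis enn2real_ennreal r)
  then have "(\<integral>\<^sup>+x. ennreal (let t = enn2real (RN_deriv \<eta> (density \<eta> (\<lambda>x. ennreal (r x))) x) in t * ln t - t + 1) \<partial>\<eta>)
      = (\<integral>\<^sup>+x. ennreal (r x * ln (r x) - r x + 1) \<partial>\<eta>)"
    by (intro nn_integral_cong_AE) (auto simp: Let_def)
  moreover have "absolutely_continuous \<eta> (density \<eta> (\<lambda>x. ennreal (r x)))"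
    by (rule absolutely_continuousI_density) simp
  ultimately show ?thesis by (simp add: KL_def)
qed

text \<open>The duality argument needs differences of integrals, hence a real density and a Bochner
  integral in place of an \<open>ennreal\<close> derivative. The derivative is finite almost
  everywhere because \<open>\<rho>\<close> is a finite measure.\<close>

lemma KL_finite_imp_density:
  assumes fin: "finite_measure \<eta>" "finite_measure \<rho>" and sets: "sets \<rho> = sets \<eta>" and KL: "KL \<rho> \<eta> < \<infinity>"
  obtains r :: "'a \<Rightarrow> real" where "r \<in> borel_measurable \<eta>" "\<And>x. 0 \<le> r x"
    "\<rho> = density \<eta> (\<lambda>x. ennreal (r x))"
    "integrable \<eta> (\<lambda>x. r x * ln (r x) - r x + 1)"
    "KL \<rho> \<eta> = ennreal (\<integral>x. r x * ln (r x) - r x + 1 \<partial>\<eta>)"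
proof -
  interpret finite_measure \<eta> by fact
  interpret R: finite_measure \<rho> by fact
  define r where "r x = enn2real (RN_deriv \<eta> \<rho> x)" for x
  have [measurable]: "r \<in> borel_measurable \<eta>" unfolding r_def by measurable
  have r0: "0 \<le> r x" for x by (simp add: r_def)
  have ac: "absolutely_continuous \<eta> \<rho>" using KL by (auto simp: KL_def split: if_splits)
  have "AE x in \<eta>. RN_deriv \<eta> \<rho> x \<noteq> \<infinity>"
    by (rule RN_deriv_finite[OF R.sigma_finite_measure_axioms ac sets])
  then have "density \<eta> (\<lambda>x. ennreal (r x)) = density \<eta> (RN_deriv \<eta> \<rho>)"
    by (intro density_cong) (auto simp: r_def less_top)
  then have dens: "\<rho> = density \<eta> (\<lambda>x. ennreal (r x))"
    using density_RN_deriv[OF ac sets] by simp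
  have eq: "KL \<rho> \<eta> = (\<integral>\<^sup>+x. ennreal (r x * ln (r x) - r x + 1) \<partial>\<eta>)"
    unfolding dens by (rule KL_density_eq[OF fin(1)]) (simp_all add: r0)
  have int: "integrable \<eta> (\<lambda>x. r x * ln (r x) - r x + 1)"
    using KL unfolding eq by (intro integrableI_nonneg) (simp_all add: KL_integrand_nonneg r0)
  then have "KL \<rho> \<eta> = ennreal (\<integral>x. r x * ln (r x) - r x + 1 \<partial>\<eta>)"
    unfolding eq by (intro nn_integral_eq_integral) (simp_all add: KL_integrand_nonneg r0)
  with that[OF _ r0 dens int] show ?thesis by simp
qed

text \<open>The exponential moment is what makes the linear term integrable against every measure of
  finite divergence.\<close>

lemma KL_dual_bound:
  fixes \<phi> :: "'a \<Rightarrow> real"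
  assumes fin: "finite_measure \<eta>" "finite_measure \<rho>" and sets: "sets \<rho> = sets \<eta>" and KL: "KL \<rho> \<eta> < \<infinity>"
    and [measurable]: "\<phi> \<in> borel_measurable \<eta>"
    and e: "0 < e" "integrable \<eta> (\<lambda>x. exp (e * \<bar>\<phi> x\<bar>))"
    and int: "integrable \<eta> (\<lambda>x. exp (- \<phi> x))"
  shows "integrable \<rho> \<phi>"
    and "measure \<eta> (space \<eta>) - (\<integral>x. exp (- \<phi> x) \<partial>\<eta>) \<le> enn2real (KL \<rho> \<eta>) + (\<integral>x. \<phi> x \<partial>\<rho>)"
    and "measure \<eta> (space \<eta>) - (\<integral>x. exp (- \<phi> x) \<partial>\<eta>) = enn2real (KL \<rho> \<eta>) + (\<integral>x. \<phi> x \<partial>\<rho>) \<Longrightarrow>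
      \<rho> = density \<eta> (\<lambda>x. ennreal (exp (- \<phi> x)))"
proof -
  interpret finite_measure \<eta> by fact
  obtain r :: "'a \<Rightarrow> real" where r [measurable]: "r \<in> borel_measurable \<eta>" and r0: "\<And>x. 0 \<le> r x"
    and dens: "\<rho> = density \<eta> (\<lambda>x. ennreal (r x))"
    and ih: "integrable \<eta> (\<lambda>x. r x * ln (r x) - r x + 1)"
    and KLr: "KL \<rho> \<eta> = ennreal (\<integral>x. r x * ln (r x) - r x + 1 \<partial>\<eta>)"
    by (rule KL_finite_imp_density[OF fin sets KL]) blast
  have KLr': "enn2real (KL \<rho> \<eta>) = (\<integral>x. r x * ln (r x) - r x + 1 \<partial>\<eta>)"
    unfolding KLr by (intro enn2real_ennreal Bochner_Integration.integral_nonneg KL_integrand_nonneg r0)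
  \<comment> \<open>The dominating function is \<open>KL_integrand_ge\<close> at
    \<open>t = - e * |\<phi> x|\<close>, solved for \<open>r x * |\<phi> x|\<close>.\<close>
  have "integrable \<eta> (\<lambda>x. ((r x * ln (r x) - r x + 1) - 1 + exp (e * \<bar>\<phi> x\<bar>)) / e)"
    by (intro integrable_divide Bochner_Integration.integrable_add[OF _ e(2)]
        Bochner_Integration.integrable_diff[OF ih]) simp
  then have ir: "integrable \<eta> (\<lambda>x. r x * \<phi> x)"
  proof (rule Bochner_Integration.integrable_bound)
    have "\<bar>r x * \<phi> x\<bar> \<le> ((r x * ln (r x) - r x + 1) - 1 + exp (e * \<bar>\<phi> x\<bar>)) / e" for x
      using KL_integrand_ge(1)[OF r0, of "- (e * \<bar>\<phi> x\<bar>)" x] e(1) r0[of x]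
      by (simp add: le_divide_eq abs_mult mult_ac)
    then show "AE x in \<eta>. norm (r x * \<phi> x) \<le> norm (((r x * ln (r x) - r x + 1) - 1 + exp (e * \<bar>\<phi> x\<bar>)) / e)"
      by (intro AE_I2) (metis abs_ge_self order_trans real_norm_def)
  qed simp
  then show i\<rho>: "integrable \<rho> \<phi>"
    unfolding dens by (subst integrable_density) (simp_all add: r0)
  have I: "(\<integral>x. \<phi> x \<partial>\<rho>) = (\<integral>x. r x * \<phi> x \<partial>\<eta>)"
    unfolding dens by (subst integral_density) (simp_all add: r0)
  \<comment> \<open>The pointwise slack of the Fenchel inequality. Its integral is the slack of the
    dual bound, so equality there makes it vanish almost everywhere and determines the
    density.\<close>
  define G where "G x = (r x * ln (r x) - r x + 1) + r x * \<phi> x - (1 - exp (- \<phi> x))" for x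
  have G0: "0 \<le> G x" for x using KL_integrand_ge(1)[OF r0, of "\<phi> x" x] by (simp add: G_def)
  have iA: "integrable \<eta> (\<lambda>x. (r x * ln (r x) - r x + 1) + r x * \<phi> x)"
    by (rule Bochner_Integration.integrable_add[OF ih ir])
  have iB: "integrable \<eta> (\<lambda>x. 1 - exp (- \<phi> x))" using int by simp
  have iG: "integrable \<eta> G"
    unfolding G_def by (rule Bochner_Integration.integrable_diff[OF iA iB])
  have GI: "(\<integral>x. G x \<partial>\<eta>) = enn2real (KL \<rho> \<eta>) + (\<integral>x. \<phi> x \<partial>\<rho>) - (measure \<eta> (space \<eta>) - (\<integral>x. exp (- \<phi> x) \<partial>\<eta>))"
  proof -
    have "(\<integral>x. G x \<partial>\<eta>) = (\<integral>x. r x * ln (r x) - r x + 1 \<partial>\<eta>) + (\<integral>x. r x * \<phi> x \<partial>\<eta>)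
        - ((\<integral>x. 1 \<partial>\<eta>) - (\<integral>x. exp (- \<phi> x) \<partial>\<eta>))"
      unfolding G_def Bochner_Integration.integral_diff[OF iA iB] Bochner_Integration.integral_add[OF ih ir]
      using int by simp
    then show ?thesis by (simp add: KLr' I)
  qed
  have "0 \<le> (\<integral>x. G x \<partial>\<eta>)" by (intro Bochner_Integration.integral_nonneg G0)
  then show "measure \<eta> (space \<eta>) - (\<integral>x. exp (- \<phi> x) \<partial>\<eta>) \<le> enn2real (KL \<rho> \<eta>) + (\<integral>x. \<phi> x \<partial>\<rho>)"
    unfolding GI by simp
  assume "measure \<eta> (space \<eta>) - (\<integral>x. exp (- \<phi> x) \<partial>\<eta>) = enn2real (KL \<rho> \<eta>) + (\<integral>x. \<phi> x \<partial>\<rho>)"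
  then have "(\<integral>x. G x \<partial>\<eta>) = 0" unfolding GI by simp
  then have "AE x in \<eta>. G x = 0" using integral_nonneg_eq_0_iff_AE[OF iG] G0 by simp
  then have "AE x in \<eta>. r x = exp (- \<phi> x)"
    by eventually_elim (rule KL_integrand_ge(2)[OF r0], simp add: G_def)
  then show "\<rho> = density \<eta> (\<lambda>x. ennreal (exp (- \<phi> x)))"
    unfolding dens by (intro density_cong) auto
qed

text \<open>This is the equality case of the dual bound: with \<open>ln r = - \<phi>\<close> the
  integrand becomes \<open>1 - exp (- \<phi>) - exp (- \<phi>) * \<phi>\<close>. The second claim
  ensures that the \<open>ennreal\<close> in the first one truncates nothing.\<close>

lemma KL_exp_density:
  fixes \<phi> :: "'a \<Rightarrow> real"
  assumes fin: "finite_measure \<eta>" and [measurable]: "\<phi> \<in> borel_measurable \<eta>"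
    and int: "integrable \<eta> (\<lambda>x. exp (- \<phi> x))"
    and \<rho>: "\<rho> = density \<eta> (\<lambda>x. ennreal (exp (- \<phi> x)))" and i\<rho>: "integrable \<rho> \<phi>"
  shows "KL \<rho> \<eta> = ennreal (measure \<eta> (space \<eta>) - (\<integral>x. exp (- \<phi> x) \<partial>\<eta>) - (\<integral>x. \<phi> x \<partial>\<rho>))"
    and "0 \<le> measure \<eta> (space \<eta>) - (\<integral>x. exp (- \<phi> x) \<partial>\<eta>) - (\<integral>x. \<phi> x \<partial>\<rho>)"
proof -
  interpret finite_measure \<eta> by fact
  have ir: "integrable \<eta> (\<lambda>x. exp (- \<phi> x) * \<phi> x)"
    using i\<rho> unfolding \<rho> by (subst (asm) integrable_density) simp_all
  have I: "(\<integral>x. \<phi> x \<partial>\<rho>) = (\<integral>x. exp (- \<phi> x) * \<phi> x \<partial>\<eta>)"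
    unfolding \<rho> by (subst integral_density) simp_all
  let ?h = "\<lambda>x. exp (- \<phi> x) * ln (exp (- \<phi> x)) - exp (- \<phi> x) + 1"
  have h: "?h = (\<lambda>x. 1 - exp (- \<phi> x) - exp (- \<phi> x) * \<phi> x)" by (simp add: fun_eq_iff)
  have ih: "integrable \<eta> ?h" unfolding h using ir int by simp
  have Ih: "(\<integral>x. ?h x \<partial>\<eta>) = measure \<eta> (space \<eta>) - (\<integral>x. exp (- \<phi> x) \<partial>\<eta>) - (\<integral>x. \<phi> x \<partial>\<rho>)"
    unfolding h I using ir int by simp
  have h0: "0 \<le> ?h x" for x by (rule KL_integrand_nonneg) simp
  have "KL \<rho> \<eta> = (\<integral>\<^sup>+x. ennreal (?h x) \<partial>\<eta>)"
    unfolding \<rho> by (rule KL_density_eq[OF fin]) simp_all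
  also have "\<dots> = ennreal (\<integral>x. ?h x \<partial>\<eta>)"
    by (rule nn_integral_eq_integral[OF ih]) (use h0 in simp)
  finally show "KL \<rho> \<eta> = ennreal (measure \<eta> (space \<eta>) - (\<integral>x. exp (- \<phi> x) \<partial>\<eta>) - (\<integral>x. \<phi> x \<partial>\<rho>))"
    unfolding Ih .
  show "0 \<le> measure \<eta> (space \<eta>) - (\<integral>x. exp (- \<phi> x) \<partial>\<eta>) - (\<integral>x. \<phi> x \<partial>\<rho>)"
    unfolding Ih[symmetric] by (intro Bochner_Integration.integral_nonneg h0)
qed

section \<open>Optimality of a graph coupling certified by dual potentials\<close>

lemma borel_measurable_fst_snd [measurable]:
  "fst \<in> borel_measurable (borel :: ('a::euclidean_space \<times> 'b::euclidean_space) measure)"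
  "snd \<in> borel_measurable (borel :: ('a::euclidean_space \<times> 'b::euclidean_space) measure)"
  by (auto intro!: borel_measurable_continuous_onI continuous_intros)

lemma ennreal_add_mults:
  assumes "0 \<le> c" "0 \<le> k" "0 \<le> l" "0 < s" "0 < t"
  shows "ennreal c + ennreal s * ennreal k + ennreal t * ennreal l = ennreal (c + s * k + t * l)"
  using assms by (simp add: ennreal_mult)

text \<open>Feasible Kantorovich potentials whose contact set is exactly the graph of
  \<open>T\<close>. In \<open>potentials_eq\<close>, the implication to the right yields uniqueness
  of the optimal plan, the one to the left the cost of the graph plan.\<close>

locale transport_certificate =
  fixes \<phi> \<psi> :: "'a::euclidean_space \<Rightarrow> real" and T :: "'a \<Rightarrow> 'a"
  assumes measurable_certificate [measurable]:
      "\<phi> \<in> borel_measurable borel" "\<psi> \<in> borel_measurable borel" "T \<in> borel_measurable borel"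
    and potentials_le: "\<phi> x + \<psi> y \<le> (norm (x - y))\<^sup>2"
    and potentials_eq: "\<phi> x + \<psi> y = (norm (x - y))\<^sup>2 \<longleftrightarrow> y = T x"
begin

lemma transport_cost_ge:
  assumes sets [measurable_cong]: "sets \<gamma> = sets borel"
    and i0: "integrable (first_marginal \<gamma>) \<phi>" and i1: "integrable (second_marginal \<gamma>) \<psi>"
    and fin: "transport_cost \<gamma> < \<infinity>"
  shows "(\<integral>x. \<phi> x \<partial>first_marginal \<gamma>) + (\<integral>y. \<psi> y \<partial>second_marginal \<gamma>) \<le> enn2real (transport_cost \<gamma>)"
    and "(\<integral>x. \<phi> x \<partial>first_marginal \<gamma>) + (\<integral>y. \<psi> y \<partial>second_marginal \<gamma>) = enn2real (transport_cost \<gamma>) \<Longrightarrow>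
      \<gamma> = distr (first_marginal \<gamma>) borel (\<lambda>x. (x, T x))"
proof -
  let ?c = "\<lambda>z::'a\<times>'a. (norm (fst z - snd z))\<^sup>2"
  have j0: "integrable \<gamma> (\<lambda>z. \<phi> (fst z))" and I0: "(\<integral>x. \<phi> x \<partial>first_marginal \<gamma>) = (\<integral>z. \<phi> (fst z) \<partial>\<gamma>)"
    using i0 by (simp_all add: integrable_distr_eq integral_distr)
  have j1: "integrable \<gamma> (\<lambda>z. \<psi> (snd z))" and I1: "(\<integral>x. \<psi> x \<partial>second_marginal \<gamma>) = (\<integral>z. \<psi> (snd z) \<partial>\<gamma>)"
    using i1 by (simp_all add: integrable_distr_eq integral_distr)
  have jc: "integrable \<gamma> ?c"
    using fin by (intro integrableI_nonneg) (simp_all add: transport_cost_def)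
  have Ic: "enn2real (transport_cost \<gamma>) = (\<integral>z. ?c z \<partial>\<gamma>)"
    unfolding transport_cost_def by (subst nn_integral_eq_integral[OF jc]) simp_all
  \<comment> \<open>The slack of dual feasibility. If its integral is zero, \<open>\<gamma>\<close>
    charges only the graph of \<open>T\<close> and is recovered from its first marginal.\<close>
  define G where "G z = ?c z - (\<phi> (fst z) + \<psi> (snd z))" for z
  have G0: "0 \<le> G z" for z using potentials_le by (simp add: G_def)
  have iG: "integrable \<gamma> G" unfolding G_def using j0 j1 jc by simp
  have IG: "(\<integral>z. G z \<partial>\<gamma>) = enn2real (transport_cost \<gamma>) -
      ((\<integral>x. \<phi> x \<partial>first_marginal \<gamma>) + (\<integral>y. \<psi> y \<partial>second_marginal \<gamma>))"
    unfolding G_def I0 I1 Ic using j0 j1 jc by simp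
  have "0 \<le> (\<integral>z. G z \<partial>\<gamma>)" by (intro Bochner_Integration.integral_nonneg G0)
  then show "(\<integral>x. \<phi> x \<partial>first_marginal \<gamma>) + (\<integral>y. \<psi> y \<partial>second_marginal \<gamma>) \<le> enn2real (transport_cost \<gamma>)"
    unfolding IG by simp
  assume "(\<integral>x. \<phi> x \<partial>first_marginal \<gamma>) + (\<integral>y. \<psi> y \<partial>second_marginal \<gamma>) = enn2real (transport_cost \<gamma>)"
  then have "(\<integral>z. G z \<partial>\<gamma>) = 0" unfolding IG by simp
  then have "AE z in \<gamma>. G z = 0" using integral_nonneg_eq_0_iff_AE[OF iG] G0 by simp
  then have ae: "AE z in \<gamma>. z = (fst z, T (fst z))"
  proof eventually_elim
    case (elim z)
    then have "\<phi> (fst z) + \<psi> (snd z) = (norm (fst z - snd z))\<^sup>2" by (simp add: G_def)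
    then show ?case by (simp add: potentials_eq prod_eq_iff)
  qed
  have "distr (first_marginal \<gamma>) borel (\<lambda>x. (x, T x)) = distr \<gamma> borel (\<lambda>z. (fst z, T (fst z)))"
    by (simp add: distr_distr o_def)
  also have "\<dots> = distr \<gamma> borel (\<lambda>z. z)"
    using ae by (intro distr_cong_AE) (auto elim: AE_mp)
  also have "\<dots> = \<gamma>" by (rule distr_id2) (simp add: sets)
  finally show "\<gamma> = distr (first_marginal \<gamma>) borel (\<lambda>x. (x, T x))" ..
qed

lemma marginals_graph:
  assumes [measurable_cong]: "sets p = sets borel"
  shows "first_marginal (distr p borel (\<lambda>x. (x, T x))) = p"
    and "second_marginal (distr p borel (\<lambda>x. (x, T x))) = distr p borel T"
  using distr_id2[of borel p] assms by (simp_all add: distr_distr o_def)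

lemma transport_cost_graph:
  assumes sets [measurable_cong]: "sets p = sets borel"
    and i0: "integrable p \<phi>" and i1: "integrable (distr p borel T) \<psi>"
  shows "transport_cost (distr p borel (\<lambda>x. (x, T x))) = ennreal ((\<integral>x. \<phi> x \<partial>p) + (\<integral>y. \<psi> y \<partial>distr p borel T))"
    and "0 \<le> (\<integral>x. \<phi> x \<partial>p) + (\<integral>y. \<psi> y \<partial>distr p borel T)"
proof -
  have j1: "integrable p (\<lambda>x. \<psi> (T x))" and I1: "(\<integral>y. \<psi> y \<partial>distr p borel T) = (\<integral>x. \<psi> (T x) \<partial>p)"
    using i1 by (simp_all add: integrable_distr_eq integral_distr)
  have c: "(norm (x - T x))\<^sup>2 = \<phi> x + \<psi> (T x)" for x using potentials_eq[of x "T x"] by simp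
  then have c0: "0 \<le> \<phi> x + \<psi> (T x)" for x by (metis zero_le_power2)
  have I: "(\<integral>x. \<phi> x \<partial>p) + (\<integral>y. \<psi> y \<partial>distr p borel T) = (\<integral>x. \<phi> x + \<psi> (T x) \<partial>p)"
    unfolding I1 using i0 j1 by simp
  then show "0 \<le> (\<integral>x. \<phi> x \<partial>p) + (\<integral>y. \<psi> y \<partial>distr p borel T)"
    by (simp add: c0)
  have "transport_cost (distr p borel (\<lambda>x. (x, T x))) = (\<integral>\<^sup>+x. ennreal (\<phi> x + \<psi> (T x)) \<partial>p)"
    by (simp add: transport_cost_def nn_integral_distr c)
  also have "\<dots> = ennreal (\<integral>x. \<phi> x + \<psi> (T x) \<partial>p)"
    using i0 j1 c0 by (intro nn_integral_eq_integral) simp_all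
  finally show "transport_cost (distr p borel (\<lambda>x. (x, T x))) = ennreal ((\<integral>x. \<phi> x \<partial>p) + (\<integral>y. \<psi> y \<partial>distr p borel T))"
    unfolding I .
qed

lemma graph_in_couplings:
  assumes "sets p = sets borel"
  shows "distr p borel (\<lambda>x. (x, T x)) \<in> couplings p (distr p borel T)"
  using marginals_graph[OF assms] by (simp add: couplings_def)

text \<open>Each coupling of finite cost satisfies weak duality, and the graph coupling attains the
  dual value.\<close>

lemma W2_squared_eq:
  assumes sets: "sets p = sets borel"
    and i0: "integrable p \<phi>" and i1: "integrable (distr p borel T) \<psi>"
  shows "W2_squared p (distr p borel T) = ennreal ((\<integral>x. \<phi> x \<partial>p) + (\<integral>y. \<psi> y \<partial>distr p borel T))"
proof (rule antisym)
  show "W2_squared p (distr p borel T) \<le> ennreal ((\<integral>x. \<phi> x \<partial>p) + (\<integral>y. \<psi> y \<partial>distr p borel T))"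
    unfolding W2_squared_def
    using INF_lower[OF graph_in_couplings[OF sets], of transport_cost] transport_cost_graph(1)[OF assms] by simp
  show "ennreal ((\<integral>x. \<phi> x \<partial>p) + (\<integral>y. \<psi> y \<partial>distr p borel T)) \<le> W2_squared p (distr p borel T)"
    unfolding W2_squared_def
  proof (rule INF_greatest)
    fix \<pi> assume \<pi>: "\<pi> \<in> couplings p (distr p borel T)"
    show "ennreal ((\<integral>x. \<phi> x \<partial>p) + (\<integral>y. \<psi> y \<partial>distr p borel T)) \<le> transport_cost \<pi>"
    proof (cases "transport_cost \<pi> < \<infinity>")
      case True
      then have "(\<integral>x. \<phi> x \<partial>p) + (\<integral>y. \<psi> y \<partial>distr p borel T) \<le> enn2real (transport_cost \<pi>)"
        using transport_cost_ge(1)[of \<pi>] \<pi> i0 i1 by (simp add: couplings_def)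
      then have "ennreal ((\<integral>x. \<phi> x \<partial>p) + (\<integral>y. \<psi> y \<partial>distr p borel T)) \<le> ennreal (enn2real (transport_cost \<pi>))"
        by (rule ennreal_leI)
      then show ?thesis using True by (metis ennreal_enn2real infinity_ennreal_def)
    next
      case False
      then have "transport_cost \<pi> = top" by (simp add: not_less top_unique)
      then show ?thesis by simp
    qed
  qed
qed

theorem W2_optimal_coupling_iff:
  assumes sets: "sets p = sets borel"
    and i0: "integrable p \<phi>" and i1: "integrable (distr p borel T) \<psi>"
  shows "W2_optimal_coupling p (distr p borel T) \<pi> \<longleftrightarrow> \<pi> = distr p borel (\<lambda>x. (x, T x))"
proof
  assume \<pi>: "W2_optimal_coupling p (distr p borel T) \<pi>"
  then have c: "\<pi> \<in> couplings p (distr p borel T)"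
    and "transport_cost \<pi> = ennreal ((\<integral>x. \<phi> x \<partial>p) + (\<integral>y. \<psi> y \<partial>distr p borel T))"
    by (simp_all add: W2_optimal_coupling_def W2_squared_eq[OF assms])
  then show "\<pi> = distr p borel (\<lambda>x. (x, T x))"
    using transport_cost_ge(2)[of \<pi>] i0 i1 transport_cost_graph(2)[OF assms] by (simp add: couplings_def)
next
  assume "\<pi> = distr p borel (\<lambda>x. (x, T x))"
  then show "W2_optimal_coupling p (distr p borel T) \<pi>"
    by (simp add: W2_optimal_coupling_def graph_in_couplings[OF sets] W2_squared_eq[OF assms]
        transport_cost_graph(1)[OF assms])
qed

end

text \<open>The reweighted measures \<open>\<alpha>'\<close> and \<open>\<beta>'\<close> realise
  equality in the Fenchel inequalities for the two divergences, with potentials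
  \<open>\<phi> / \<tau>0\<close> and \<open>\<psi> / \<tau>1\<close>. The assumption
  \<open>transport\<close> makes them the marginals of one plan on the contact set, so that all
  three inequalities are tight at once.\<close>

locale uot_certificate = transport_certificate \<phi> \<psi> T
  for \<phi> \<psi> :: "'a::euclidean_space \<Rightarrow> real" and T :: "'a \<Rightarrow> 'a" +
  fixes \<alpha> \<beta> \<alpha>' \<beta>' :: "'a measure" and \<tau>0 \<tau>1 e0 e1 :: real
  assumes \<tau>: "0 < \<tau>0" "0 < \<tau>1"
    and sets_\<alpha>\<beta> [measurable_cong, simp]: "sets \<alpha> = sets borel" "sets \<beta> = sets borel"
    and finite_\<alpha>\<beta>: "finite_measure \<alpha>" "finite_measure \<beta>"
    and e: "0 < e0" "0 < e1"
    and exp_moments: "integrable \<alpha> (\<lambda>x. exp (e0 * \<bar>\<phi> x / \<tau>0\<bar>))" "integrable \<beta> (\<lambda>x. exp (e1 * \<bar>\<psi> x / \<tau>1\<bar>))"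
    and exp_integrable: "integrable \<alpha> (\<lambda>x. exp (- (\<phi> x / \<tau>0)))" "integrable \<beta> (\<lambda>x. exp (- (\<psi> x / \<tau>1)))"
    and \<alpha>': "\<alpha>' = density \<alpha> (\<lambda>x. ennreal (exp (- (\<phi> x / \<tau>0))))"
    and \<beta>': "\<beta>' = density \<beta> (\<lambda>x. ennreal (exp (- (\<psi> x / \<tau>1))))"
    and potentials_integrable: "integrable \<alpha>' \<phi>" "integrable \<beta>' \<psi>"
    and transport: "distr \<alpha>' borel T = \<beta>'"
begin

definition "minimizer = distr \<alpha>' borel (\<lambda>x. (x, T x))"

text \<open>The value of the dual problem at the pair of potentials.\<close>

definition "minimum = \<tau>0 * (measure \<alpha> (space \<alpha>) - (\<integral>x. exp (- (\<phi> x / \<tau>0)) \<partial>\<alpha>))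
  + \<tau>1 * (measure \<beta> (space \<beta>) - (\<integral>x. exp (- (\<psi> x / \<tau>1)) \<partial>\<beta>))"

lemma space_\<alpha>\<beta> [simp]: "space \<alpha> = UNIV" "space \<beta> = UNIV"
  using sets_\<alpha>\<beta>[THEN sets_eq_imp_space_eq] by simp_all

lemma sets_\<alpha>' [measurable_cong, simp]: "sets \<alpha>' = sets borel"
  by (simp add: \<alpha>')

lemma minimizer_mem: "minimizer \<in> finite_borel_measures"
proof -
  have "emeasure \<alpha>' (space \<alpha>') = (\<integral>\<^sup>+x. ennreal (exp (- (\<phi> x / \<tau>0))) \<partial>\<alpha>)"
    unfolding \<alpha>' by (subst emeasure_density) (auto intro!: nn_integral_cong)
  also have "\<dots> < \<infinity>" using exp_integrable(1) by (simp add: integrable_iff_bounded)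
  finally have "finite_measure \<alpha>'" by (intro finite_measureI) simp
  then have "finite_measure minimizer" unfolding minimizer_def by (rule finite_measure.finite_measure_distr) simp
  then show ?thesis by (simp add: finite_borel_measures_def minimizer_def)
qed

text \<open>The integrals of \<open>\<phi>\<close> and \<open>\<psi>\<close> that make up the
  transport cost cancel against those in the two divergences, leaving the dual value.\<close>

lemma UOT_functional_minimizer:
  "UOT_functional \<tau>0 \<tau>1 \<alpha> \<beta> minimizer = ennreal minimum" "0 \<le> minimum"
proof -
  let ?I = "\<integral>x. \<phi> x \<partial>\<alpha>'" and ?J = "\<integral>x. \<psi> x \<partial>\<beta>'"
  let ?k = "measure \<alpha> (space \<alpha>) - (\<integral>x. exp (- (\<phi> x / \<tau>0)) \<partial>\<alpha>) - (\<integral>x. \<phi> x / \<tau>0 \<partial>\<alpha>')"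
  let ?l = "measure \<beta> (space \<beta>) - (\<integral>x. exp (- (\<psi> x / \<tau>1)) \<partial>\<beta>) - (\<integral>x. \<psi> x / \<tau>1 \<partial>\<beta>')"
  have "integrable \<alpha>' (\<lambda>x. \<phi> x / \<tau>0)" using potentials_integrable by simp
  then have k: "KL \<alpha>' \<alpha> = ennreal ?k" "0 \<le> ?k"
    using KL_exp_density[OF finite_\<alpha>\<beta>(1) _ exp_integrable(1) \<alpha>'] by simp_all
  have "integrable \<beta>' (\<lambda>x. \<psi> x / \<tau>1)" using potentials_integrable by simp
  then have l: "KL \<beta>' \<beta> = ennreal ?l" "0 \<le> ?l"
    using KL_exp_density[OF finite_\<alpha>\<beta>(2) _ exp_integrable(2) \<beta>'] by simp_all
  have c: "transport_cost minimizer = ennreal (?I + ?J)" "0 \<le> ?I + ?J"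
    using transport_cost_graph[of \<alpha>'] potentials_integrable unfolding minimizer_def transport by simp_all
  have m: "first_marginal minimizer = \<alpha>'" "second_marginal minimizer = \<beta>'"
    using marginals_graph[of \<alpha>'] unfolding minimizer_def transport by simp_all
  have eq: "(?I + ?J) + \<tau>0 * ?k + \<tau>1 * ?l = minimum"
    using \<tau> by (simp add: minimum_def algebra_simps)
  have "0 \<le> \<tau>0 * ?k" "0 \<le> \<tau>1 * ?l" using k(2) l(2) \<tau> by (intro mult_nonneg_nonneg; simp)+
  then show "0 \<le> minimum" unfolding eq[symmetric] using c(2) by linarith
  show "UOT_functional \<tau>0 \<tau>1 \<alpha> \<beta> minimizer = ennreal minimum"
    unfolding eq[symmetric] UOT_functional_def m k(1) l(1) c(1)
    by (rule ennreal_add_mults) (use k(2) l(2) c(2) \<tau> in simp_all)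
qed

lemma UOT_functional_ge:
  assumes \<gamma>: "\<gamma> \<in> finite_borel_measures"
  shows "ennreal minimum \<le> UOT_functional \<tau>0 \<tau>1 \<alpha> \<beta> \<gamma>"
    and "UOT_functional \<tau>0 \<tau>1 \<alpha> \<beta> \<gamma> = ennreal minimum \<Longrightarrow> \<gamma> = minimizer"
proof -
  have sets [measurable_cong]: "sets \<gamma> = sets borel" and "finite_measure \<gamma>"
    using \<gamma> by (auto simp: finite_borel_measures_def)
  let ?p = "first_marginal \<gamma>" and ?q = "second_marginal \<gamma>"
  let ?F = "UOT_functional \<tau>0 \<tau>1 \<alpha> \<beta> \<gamma>"
  have fin: "finite_measure ?p" "finite_measure ?q"
    using \<open>finite_measure \<gamma>\<close> by (auto intro!: finite_measure.finite_measure_distr)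
  \<comment> \<open>For a competitor of finite value each of the three terms is finite, which
    permits subtraction in the reals.\<close>
  have main: "minimum \<le> enn2real ?F \<and> (enn2real ?F = minimum \<longrightarrow> \<gamma> = minimizer)" if "?F < \<infinity>"
  proof -
    have fc: "transport_cost \<gamma> < \<infinity>" and f0: "ennreal \<tau>0 * KL ?p \<alpha> < \<infinity>" and f1: "ennreal \<tau>1 * KL ?q \<beta> < \<infinity>"
      using that by (auto simp: UOT_functional_def)
    then have fp: "KL ?p \<alpha> < \<infinity>" and fq: "KL ?q \<beta> < \<infinity>"
      using \<tau> by (auto simp: ennreal_mult_less_top)
    have F: "enn2real ?F = enn2real (transport_cost \<gamma>) + \<tau>0 * enn2real (KL ?p \<alpha>) + \<tau>1 * enn2real (KL ?q \<beta>)"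
      using fc f0 f1 \<tau> by (simp add: UOT_functional_def enn2real_plus enn2real_mult)
    note P = KL_dual_bound[OF finite_\<alpha>\<beta>(1) fin(1) _ fp _ e(1) exp_moments(1) exp_integrable(1), simplified]
    note Q = KL_dual_bound[OF finite_\<alpha>\<beta>(2) fin(2) _ fq _ e(2) exp_moments(2) exp_integrable(2), simplified]
    have i: "integrable ?p \<phi>" "integrable ?q \<psi>"
      using integrable_mult_right[OF P(1), of \<tau>0] integrable_mult_right[OF Q(1), of \<tau>1] \<tau> by simp_all
    note C = transport_cost_ge[OF sets i fc]
    let ?I = "\<integral>x. \<phi> x \<partial>?p" and ?J = "\<integral>x. \<psi> x \<partial>?q"
    \<comment> \<open>The excess over the minimum splits into three nonnegative slacks:
      \<open>x\<close> and \<open>y\<close> for the divergences, \<open>z\<close> for the transport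
      cost.\<close>
    define x where "x = enn2real (KL ?p \<alpha>) + ?I / \<tau>0 - (measure \<alpha> (space \<alpha>) - (\<integral>x. exp (- (\<phi> x / \<tau>0)) \<partial>\<alpha>))"
    define y where "y = enn2real (KL ?q \<beta>) + ?J / \<tau>1 - (measure \<beta> (space \<beta>) - (\<integral>x. exp (- (\<psi> x / \<tau>1)) \<partial>\<beta>))"
    define z where "z = enn2real (transport_cost \<gamma>) - (?I + ?J)"
    have nn: "0 \<le> x" "0 \<le> y" "0 \<le> z" using P(2) Q(2) C(1) by (simp_all add: x_def y_def z_def)
    have sum: "enn2real ?F - minimum = z + \<tau>0 * x + \<tau>1 * y"
      using \<tau> by (simp add: F minimum_def x_def y_def z_def algebra_simps)
    have "0 \<le> \<tau>0 * x" "0 \<le> \<tau>1 * y" using nn \<tau> by simp_all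
    moreover have "\<gamma> = minimizer" if "enn2real ?F = minimum"
    proof -
      \<comment> \<open>\<open>z = 0\<close> places \<open>\<gamma>\<close> on the graph and
        \<open>x = 0\<close> identifies its first marginal; together they determine
        \<open>\<gamma>\<close>.\<close>
      have "z = 0" "\<tau>0 * x = 0" using that sum nn calculation by linarith+
      then have "z = 0" "x = 0" using \<tau> by simp_all
      then have "\<gamma> = distr ?p borel (\<lambda>x. (x, T x))" "?p = \<alpha>'"
        using C(2) P(3) by (simp_all add: z_def x_def \<alpha>')
      then show ?thesis by (simp add: minimizer_def)
    qed
    ultimately show ?thesis using sum nn by linarith
  qed
  show "ennreal minimum \<le> ?F"
  proof (cases "?F < \<infinity>")
    case True
    then show ?thesis using main by (metis ennreal_enn2real ennreal_leI infinity_ennreal_def)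
  next
    case False
    then show ?thesis by (simp add: not_less top_unique)
  qed
  show "\<gamma> = minimizer" if "?F = ennreal minimum"
    using main that UOT_functional_minimizer(2) by simp
qed

theorem is_arg_min_iff:
  "is_arg_min (UOT_functional \<tau>0 \<tau>1 \<alpha> \<beta>) (\<lambda>\<gamma>. \<gamma> \<in> finite_borel_measures) \<gamma> \<longleftrightarrow> \<gamma> = minimizer"
  using minimizer_mem UOT_functional_minimizer(1) UOT_functional_ge
  unfolding is_arg_min_def by (metis antisym_conv2 leD)

theorem UOT_value_eq: "UOT_value \<tau>0 \<tau>1 \<alpha> \<beta> = ennreal minimum"
  unfolding UOT_value_def
  by (rule antisym)
    (use INF_lower[OF minimizer_mem, of "UOT_functional \<tau>0 \<tau>1 \<alpha> \<beta>"] UOT_functional_minimizer(1)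
      UOT_functional_ge(1) in \<open>auto intro: INF_greatest\<close>)

end

section \<open>The Gaussian solution\<close>

locale uot_gaussian_data =
  fixes m0 m1 :: "real^'n" and \<Sigma>0 \<Sigma>1 :: "real^'n^'n" and \<tau>0 \<tau>1 :: real
  assumes \<Sigma>0: "positive_definite \<Sigma>0" and \<Sigma>1: "positive_definite \<Sigma>1"
    and \<tau>0: "0 < \<tau>0" and \<tau>1: "0 < \<tau>1"
begin

abbreviation "r0 \<equiv> 2 / \<tau>0"
abbreviation "r1 \<equiv> 2 / \<tau>1"
abbreviation "A0 \<equiv> matrix_inv \<Sigma>0"
abbreviation "A1 \<equiv> matrix_inv \<Sigma>1"
abbreviation "S \<equiv> S_star \<Sigma>0 \<Sigma>1 \<tau>0 \<tau>1"
abbreviation "L \<equiv> L_star \<Sigma>0 \<Sigma>1 \<tau>0 \<tau>1"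
abbreviation "P \<equiv> P_star \<Sigma>0 \<Sigma>1 \<tau>0 \<tau>1"
abbreviation "Q \<equiv> Q_star \<Sigma>0 \<Sigma>1 \<tau>0 \<tau>1"
abbreviation "h \<equiv> h_star m0 m1 \<Sigma>0 \<Sigma>1 \<tau>0 \<tau>1"
abbreviation "u \<equiv> u_star m0 m1 \<Sigma>0 \<Sigma>1 \<tau>0 \<tau>1"
abbreviation "v \<equiv> v_star m0 m1 \<Sigma>0 \<Sigma>1 \<tau>0 \<tau>1"

definition "C0 = A0 + r0 *\<^sub>R mat 1"
definition "C1 = A1 + r1 *\<^sub>R mat 1"
definition "D = matrix_sqrt C1"
text \<open>The precision matrix of the first marginal, so that \<open>P\<close> is its
  inverse.\<close>

definition "N = A0 + r0 *\<^sub>R (mat 1 - L)"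

section \<open>The Riccati equation and positivity of the covariances\<close>

lemma positive_definite_C: "positive_definite C0" "positive_definite C1"
  unfolding C0_def C1_def
  using \<Sigma>0 \<Sigma>1 \<tau>0 \<tau>1
  by (auto intro!: positive_definite_add positive_semidefinite_scaleR positive_definite_matrix_inv
      positive_definite_imp_semidefinite[OF positive_definite_mat_1])

lemma C_vector: "C0 *v x = A0 *v x + r0 *\<^sub>R x" "C1 *v x = A1 *v x + r1 *\<^sub>R x"
  by (simp_all add: C0_def C1_def matrix_vector_mult_add_rdistrib scaleR_matrix_vector_assoc[symmetric])

lemma positive_definite_D: "positive_definite D"
  unfolding D_def by (rule positive_definite_sqrt[OF positive_definite_C(2)])

lemma D_D: "D *v (D *v x) = C1 *v x"
  using matrix_sqrt(2)[OF positive_definite_imp_semidefinite[OF positive_definite_C(2)]]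
  by (simp add: D_def matrix_vector_mul_assoc)

text \<open>Completing the square, \<open>(2 S - k)\<^sup>2 = k\<^sup>2 + 4 G\<close>, works as for
  numbers because \<open>k\<close> is scalar. The equation is the Riccati equation for
  \<open>L\<close> conjugated by \<open>D\<close>, the root of \<open>C1\<close>, which turns the
  term \<open>L C1 L\<close> into a plain square.\<close>

lemma S_star_properties:
  shows "positive_definite S"
    and "S *v (S *v x) = (r1 - r0) *\<^sub>R (S *v x) + D *v (C0 *v (D *v x))"
proof -
  define k where "k = r1 - r0"
  define G where "G = D ** C0 ** D"
  define W where "W = k\<^sup>2 *\<^sub>R mat 1 + 4 *\<^sub>R G"
  define R where "R = matrix_sqrt W"
  have G: "positive_definite G"
    unfolding G_def using positive_definite_D
    by (intro positive_definite_congruence positive_definite_C positive_definite_invertible positive_definite_symmetric)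
  have "positive_definite (4 *\<^sub>R G + k\<^sup>2 *\<^sub>R mat 1)"
    using G by (intro positive_definite_add positive_definite_scaleR positive_semidefinite_scaleR
        positive_definite_imp_semidefinite[OF positive_definite_mat_1]) simp_all
  then have W: "positive_definite W" by (simp add: W_def add.commute)
  have R: "positive_semidefinite R" "R ** R = W"
    using matrix_sqrt[OF positive_definite_imp_semidefinite[OF W]] by (simp_all add: R_def)
  have S: "S = (1 / 2) *\<^sub>R (k *\<^sub>R mat 1 + R)"
    by (simp add: S_star_def Let_def R_def W_def G_def D_def C1_def C0_def k_def)
  have Sx: "S *v x = (1 / 2) *\<^sub>R (k *\<^sub>R x + R *v x)" for x
    by (simp add: S matrix_vector_mult_add_rdistrib scaleR_matrix_vector_assoc[symmetric])
  have RR: "R *v (R *v x) = k\<^sup>2 *\<^sub>R x + 4 *\<^sub>R (G *v x)" for x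
    by (simp add: R(2) matrix_vector_mul_assoc)
      (simp add: W_def matrix_vector_mult_add_rdistrib scaleR_matrix_vector_assoc[symmetric])
  have SS: "S *v (S *v x) = k *\<^sub>R (S *v x) + G *v x" for x
  proof -
    have "S *v (S *v x) = (1 / 4) *\<^sub>R (k\<^sup>2 *\<^sub>R x + (2 * k) *\<^sub>R (R *v x) + R *v (R *v x))"
      by (simp add: Sx matrix_vector_right_distrib matrix_vector_mult_scaleR scaleR_add_right
          power2_eq_square scaleR_add_left[symmetric])
        (simp add: vec_eq_iff field_simps)
    also have "\<dots> = k *\<^sub>R (S *v x) + G *v x"
      unfolding RR Sx by (simp add: vec_eq_iff field_simps power2_eq_square)
    finally show ?thesis .
  qed
  then show "S *v (S *v x) = (r1 - r0) *\<^sub>R (S *v x) + D *v (C0 *v (D *v x))"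
    by (simp add: G_def k_def matrix_vector_mul_assoc[symmetric])
  have symR: "transpose R = R" using R by (simp add: positive_semidefinite_def)
  \<comment> \<open>Since \<open>k\<close> may be negative, positivity cannot be read off the
    formula. At an eigenvalue \<open>s\<close>, positivity of \<open>R\<close> gives
    \<open>s + (s - k) \<ge> 0\<close> and positivity of \<open>G\<close> gives
    \<open>s * (s - k) > 0\<close>; hence both factors are positive.\<close>
  show "positive_definite S"
  proof (rule positive_definite_eigenvaluesI)
    show "transpose S = S"
      by (rule symmetric_matrixI) (simp add: Sx inner_simps symmetric_matrix_inner[OF symR])
    fix w s assume w: "norm w = 1" and eig: "S *v w = s *\<^sub>R w"
    have ww: "w \<bullet> w = 1" using w by (simp add: dot_square_norm)
    have "R *v w = (2 * s - k) *\<^sub>R w"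
    proof -
      have "k *\<^sub>R w + R *v w = 2 *\<^sub>R (s *\<^sub>R w)" using eig by (simp add: Sx[of w] flip: eig)
      then show ?thesis by (simp add: algebra_simps)
    qed
    moreover have "0 \<le> w \<bullet> (R *v w)" using R by (simp add: positive_semidefinite_def)
    ultimately have ge: "0 \<le> 2 * s - k" by (simp add: ww)
    have "G *v w = (s * (s - k)) *\<^sub>R w"
      using SS[of w] by (simp add: eig matrix_vector_mult_scaleR algebra_simps)
    moreover have "0 < w \<bullet> (G *v w)" using w by (intro positive_definite_inner_pos[OF G]) auto
    ultimately have "0 < s * (s - k)" by (simp add: ww)
    then show "0 < s" using ge by (auto simp: zero_less_mult_iff)
  qed
qed

lemma L_vector: "L *v x = matrix_inv D *v (S *v (matrix_inv D *v x))"
  by (simp add: L_star_def Let_def D_def C1_def matrix_vector_mul_assoc matrix_mul_assoc)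

lemma positive_definite_L: "positive_definite L"
proof -
  have "L = matrix_inv D ** S ** matrix_inv D"
    by (simp add: L_star_def Let_def D_def C1_def)
  then show ?thesis
    using positive_definite_matrix_inv[OF positive_definite_D]
    by (simp add: positive_definite_congruence S_star_properties(1) positive_definite_invertible
        positive_definite_symmetric)
qed

text \<open>As \<open>C1 = D D\<close>, the inner factors cancel and the left side is
  \<open>D\<^sup>-\<^sup>1 S S D\<^sup>-\<^sup>1\<close>, to which the quadratic equation of
  \<open>S\<close> applies.\<close>

lemma L_C1_L: "L *v (C1 *v (L *v x)) = (r1 - r0) *\<^sub>R (L *v x) + C0 *v x"
proof -
  note inv = matrix_inv_vector[OF positive_definite_invertible[OF positive_definite_D]]
  show ?thesis
    by (simp add: L_vector D_D[symmetric] inv S_star_properties(2) matrix_vector_right_distrib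
        matrix_vector_mult_scaleR)
qed

lemma N_vector: "N *v x = A0 *v x + r0 *\<^sub>R (x - L *v x)"
  by (simp add: N_def matrix_vector_mult_add_rdistrib scaleR_matrix_vector_assoc[symmetric]
      matrix_vector_mult_diff_rdistrib)

text \<open>The view from the second marginal: the right side is
  \<open>L (A1 + r1 (I - L\<^sup>-\<^sup>1)) L\<close>, and the middle factor will be the precision
  of \<open>Q\<close>. The Riccati equation says that the two views agree.\<close>

lemma N_vector': "N *v x = L *v (A1 *v (L *v x)) + r1 *\<^sub>R (L *v (L *v x) - L *v x)"
proof -
  have "N *v x = C0 *v x - r0 *\<^sub>R (L *v x)" by (simp add: N_vector C_vector algebra_simps)
  also have "\<dots> = L *v (C1 *v (L *v x)) - r1 *\<^sub>R (L *v x)" by (simp add: L_C1_L algebra_simps)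
  finally show ?thesis
    by (simp add: C_vector matrix_vector_right_distrib matrix_vector_mult_scaleR algebra_simps)
qed

text \<open>If \<open>x \<bullet> N x \<le> 0\<close>, the two expressions for \<open>N\<close> would give \<open>x \<bullet> L x > x \<bullet> x\<close> and
  \<open>x \<bullet> L x > L x \<bullet> L x\<close>, against the Cauchy--Schwarz inequality.\<close>

lemma positive_definite_N: "positive_definite N"
proof -
  have symL: "transpose L = L" by (rule positive_definite_symmetric[OF positive_definite_L])
  have pdA: "positive_definite A0" "positive_definite A1"
    using \<Sigma>0 \<Sigma>1 by (simp_all add: positive_definite_matrix_inv)
  have "transpose N = N"
    by (rule symmetric_matrixI) (simp add: N_vector inner_simps symmetric_matrix_inner[OF symL]
        symmetric_matrix_inner[OF positive_definite_symmetric[OF pdA(1)]])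
  moreover have "0 < x \<bullet> (N *v x)" if x: "x \<noteq> 0" for x
  proof (rule ccontr)
    assume "\<not> 0 < x \<bullet> (N *v x)"
    then have neg: "x \<bullet> (N *v x) \<le> 0" by simp
    define y where "y = L *v x"
    have y: "y \<noteq> 0"
      using positive_definite_inner_pos[OF positive_definite_L x] by (auto simp: y_def)
    have "x \<bullet> (N *v x) = x \<bullet> (A0 *v x) + r0 * (x \<bullet> x - x \<bullet> y)"
      by (simp add: N_vector y_def inner_simps)
    moreover have "0 < x \<bullet> (A0 *v x)" by (rule positive_definite_inner_pos[OF pdA(1) x])
    ultimately have "r0 * (x \<bullet> x - x \<bullet> y) < 0" using neg by linarith
    then have 1: "x \<bullet> x < x \<bullet> y" using \<tau>0 by (simp add: mult_less_0_iff divide_less_0_iff)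
    have "x \<bullet> (N *v x) = y \<bullet> (A1 *v y) + r1 * (y \<bullet> y - x \<bullet> y)"
      by (simp add: N_vector' y_def inner_simps symmetric_matrix_inner[OF symL])
    moreover have "0 < y \<bullet> (A1 *v y)" by (rule positive_definite_inner_pos[OF pdA(2) y])
    ultimately have "r1 * (y \<bullet> y - x \<bullet> y) < 0" using neg by linarith
    then have 2: "y \<bullet> y < x \<bullet> y" using \<tau>1 by (simp add: mult_less_0_iff divide_less_0_iff)
    have "0 \<le> (x - y) \<bullet> (x - y)" by simp
    then show False using 1 2 by (simp add: inner_simps inner_commute)
  qed
  ultimately show ?thesis by (simp add: positive_definite_def)
qed

lemma P_eq: "P = matrix_inv N"
  by (simp add: P_star_def N_def Let_def)

lemma matrix_inv_P: "matrix_inv P = N"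
  by (simp add: P_eq matrix_inv_matrix_inv positive_definite_invertible positive_definite_N)

lemma positive_definite_P: "positive_definite P"
  by (simp add: P_eq positive_definite_matrix_inv positive_definite_N)

lemma positive_definite_Q: "positive_definite Q"
  unfolding Q_star_def
  using positive_definite_L
  by (intro positive_definite_congruence positive_definite_P positive_definite_invertible positive_definite_symmetric)

lemma matrix_inv_Q: "matrix_inv Q *v y = A1 *v y + r1 *\<^sub>R (y - matrix_inv L *v y)"
proof -
  note iL = positive_definite_invertible[OF positive_definite_L]
  note iN = positive_definite_invertible[OF positive_definite_N]
  define z where "z = matrix_inv L *v y"
  have y: "L *v z = y" by (simp add: z_def matrix_inv_vector[OF iL])
  define w where "w = A1 *v y + r1 *\<^sub>R (y - z)"
  \<comment> \<open>Thus \<open>w\<close> is a preimage of \<open>y\<close> under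
    \<open>Q = L P L\<close>: applying \<open>P\<close> to \<open>N z\<close> returns
    \<open>z\<close>, and \<open>L z = y\<close>.\<close>
  have "L *v w = N *v z"
    by (simp add: w_def N_vector' y matrix_vector_right_distrib matrix_vector_mult_scaleR
        matrix_vector_mult_diff_distrib)
  then have "Q *v w = y"
    by (simp add: Q_star_def matrix_vector_mul_assoc[symmetric] P_eq matrix_inv_vector[OF iN] y)
  then show ?thesis
    using matrix_inv_vector(2)[OF positive_definite_invertible[OF positive_definite_Q], of w]
    by (simp add: w_def z_def)
qed

section \<open>First-order conditions for the means\<close>

lemma u_minus_v: "u - v = h"
proof -
  let ?B = "mat 1 + r0 *\<^sub>R \<Sigma>0 + r1 *\<^sub>R \<Sigma>1"
  have "positive_definite ?B"
    using \<Sigma>0 \<Sigma>1 \<tau>0 \<tau>1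
    by (intro positive_definite_add positive_definite_mat_1 positive_semidefinite_scaleR
        positive_definite_imp_semidefinite) simp_all
  then have "?B *v h = m0 - m1"
    by (simp add: h_star_def Let_def matrix_inv_vector positive_definite_invertible)
  then show ?thesis
    by (simp add: u_star_def v_star_def Let_def matrix_vector_mult_add_rdistrib
        scaleR_matrix_vector_assoc[symmetric] algebra_simps)
qed

text \<open>With \<open>A1_v\<close>, this gives the potentials the gradients \<open>2 h\<close> at
  \<open>u\<close> and \<open>- 2 h\<close> at \<open>v\<close>, matching the cost because
  \<open>u - v = h\<close>.\<close>

lemma A0_u: "A0 *v (u - m0) = - (r0 *\<^sub>R h)"
  using \<Sigma>0 by (simp add: u_star_def Let_def matrix_vector_mult_scaleR matrix_inv_vector
      positive_definite_invertible linear_neg[OF matrix_vector_mul_linear])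

lemma A1_v: "A1 *v (v - m1) = r1 *\<^sub>R h"
  using \<Sigma>1 by (simp add: v_star_def Let_def matrix_vector_mult_scaleR matrix_inv_vector
      positive_definite_invertible)

end

text \<open>The negative logarithm of the density of one Gaussian with respect to another; the
  determinants come from the normalising constants. With this sign, \<open>\<tau>\<close> times the
  function is a potential up to an additive constant.\<close>

definition gaussian_log_ratio :: "real^'n \<Rightarrow> real^'n^'n \<Rightarrow> real^'n \<Rightarrow> real^'n^'n \<Rightarrow> real^'n \<Rightarrow> real" where
  "gaussian_log_ratio u P m \<Sigma> x =
    ((x - u) \<bullet> (matrix_inv P *v (x - u)) - (x - m) \<bullet> (matrix_inv \<Sigma> *v (x - m))) / 2
      + (ln (det P) - ln (det \<Sigma>)) / 2"

lemma borel_measurable_gaussian_log_ratio [measurable]: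
  "gaussian_log_ratio u P m \<Sigma> \<in> borel_measurable borel"
  unfolding gaussian_log_ratio_def[abs_def] by measurable

lemma gaussian_eq_density_gaussian:
  fixes P \<Sigma> :: "real^'n^'n"
  assumes P: "positive_definite P" and \<Sigma>: "positive_definite \<Sigma>"
  shows "gaussian u P = density (gaussian m \<Sigma>) (\<lambda>x. ennreal (exp (- gaussian_log_ratio u P m \<Sigma> x)))"
proof -
  let ?c = "(2 * pi) ^ CARD('n)"
  note d = det_positive_definite_pos[OF P] det_positive_definite_pos[OF \<Sigma>]
  define p where "p x = (x - u) \<bullet> (matrix_inv P *v (x - u))" for x
  define q where "q x = (x - m) \<bullet> (matrix_inv \<Sigma> *v (x - m))" for x
  have e: "exp (ln x / 2) = sqrt x" if "0 < x" for x :: real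
    using that by (simp add: ln_sqrt[symmetric])
  have "exp (- p x / 2) / sqrt (?c * det P) =
      exp (- q x / 2) / sqrt (?c * det \<Sigma>) * exp (- ((p x - q x) / 2 + (ln (det P) - ln (det \<Sigma>)) / 2))" for x
  proof -
    have "exp (- ((p x - q x) / 2 + (ln (det P) - ln (det \<Sigma>)) / 2))
        = exp (- p x / 2 - (- q x / 2) + (ln (det \<Sigma>) / 2 - ln (det P) / 2))"
      by (simp add: field_simps)
    also have "\<dots> = exp (- p x / 2) / exp (- q x / 2) * (sqrt (det \<Sigma>) / sqrt (det P))"
      unfolding exp_add exp_diff e[OF d(1)] e[OF d(2)] ..
    finally show ?thesis
      using d by (simp add: real_sqrt_mult)
  qed
  then show ?thesis
    unfolding gaussian_def
    by (subst density_density_eq)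
      (simp_all add: p_def q_def gaussian_log_ratio_def[abs_def] ennreal_mult''[symmetric])
qed

text \<open>Expanding around \<open>u\<close>, where the form of \<open>P\<close> has no linear
  term, isolates the linear coefficient \<open>matrix_inv \<Sigma> *v (u - m)\<close> governed by
  \<open>A0_u\<close> and \<open>A1_v\<close>.\<close>

lemma gaussian_log_ratio_diff:
  fixes P \<Sigma> :: "real^'n^'n"
  assumes \<Sigma>: "positive_definite \<Sigma>"
  shows "gaussian_log_ratio u P m \<Sigma> (u + z) = gaussian_log_ratio u P m \<Sigma> u
    + (z \<bullet> (matrix_inv P *v z) - z \<bullet> (matrix_inv \<Sigma> *v z)) / 2 - z \<bullet> (matrix_inv \<Sigma> *v (u - m))"
proof -
  let ?A = "matrix_inv \<Sigma>"
  define w where "w = u - m"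
  have "w \<bullet> (?A *v z) = z \<bullet> (?A *v w)"
    using symmetric_matrix_inner[OF positive_definite_symmetric[OF positive_definite_matrix_inv[OF \<Sigma>]], of w z]
    by (simp add: inner_commute)
  then have "(z + w) \<bullet> (?A *v (z + w)) = z \<bullet> (?A *v z) + 2 * (z \<bullet> (?A *v w)) + w \<bullet> (?A *v w)"
    by (simp add: matrix_vector_right_distrib inner_simps)
  moreover have "u + z - m = z + w" "u - m = w" by (simp_all add: w_def)
  ultimately show ?thesis by (simp add: gaussian_log_ratio_def field_simps)
qed

lemma quadratic_form_growth:
  fixes B :: "real^'n^'n"
  shows "\<exists>C\<ge>0. \<forall>x. \<bar>(x - u) \<bullet> (B *v (x - u))\<bar> \<le> C * (1 + (norm x)\<^sup>2)"
proof -
  obtain K where K: "0 < K" "\<And>z. norm (B *v z) \<le> norm z * K"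
    using bounded_linear.pos_bounded[OF matrix_vector_mul_bounded_linear[of B]] by blast
  have "\<bar>(x - u) \<bullet> (B *v (x - u))\<bar> \<le> (2 * K * (1 + (norm u)\<^sup>2)) * (1 + (norm x)\<^sup>2)" for x
  proof -
    have "\<bar>(x - u) \<bullet> (B *v (x - u))\<bar> \<le> norm (x - u) * norm (B *v (x - u))" by (rule Cauchy_Schwarz_ineq2)
    also have "\<dots> \<le> norm (x - u) * (norm (x - u) * K)" by (intro mult_left_mono K) simp
    also have "\<dots> = K * (norm (x - u))\<^sup>2" by (simp add: power2_eq_square)
    also have "\<dots> \<le> K * (2 * (1 + (norm u)\<^sup>2) * (1 + (norm x)\<^sup>2))"
    proof (intro mult_left_mono)
      have "(norm (x - u))\<^sup>2 \<le> (norm x + norm u)\<^sup>2"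
        by (intro power_mono norm_triangle_ineq4) simp
      also have "\<dots> \<le> 2 * (norm x)\<^sup>2 + 2 * (norm u)\<^sup>2"
        using sum_squares_bound[of "norm x" "norm u"] by (simp add: power2_sum)
      also have "\<dots> \<le> 2 * (1 + (norm u)\<^sup>2) * (1 + (norm x)\<^sup>2)" by (simp add: algebra_simps)
      finally show "(norm (x - u))\<^sup>2 \<le> 2 * (1 + (norm u)\<^sup>2) * (1 + (norm x)\<^sup>2)" .
    qed (use K in simp)
    finally show ?thesis by (simp add: mult_ac)
  qed
  then show ?thesis using K by (intro exI[of _ "2 * K * (1 + (norm u)\<^sup>2)"]) simp
qed

lemma gaussian_log_ratio_growth:
  "\<exists>C>0. \<forall>x. \<bar>gaussian_log_ratio u P m \<Sigma> x\<bar> \<le> C * (1 + (norm x)\<^sup>2)"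
proof -
  obtain C D where C: "0 \<le> C" "\<And>x. \<bar>(x - u) \<bullet> (matrix_inv P *v (x - u))\<bar> \<le> C * (1 + (norm x)\<^sup>2)"
    and D: "0 \<le> D" "\<And>x. \<bar>(x - m) \<bullet> (matrix_inv \<Sigma> *v (x - m))\<bar> \<le> D * (1 + (norm x)\<^sup>2)"
    using quadratic_form_growth by metis
  define k where "k = (ln (det P) - ln (det \<Sigma>)) / 2"
  have "\<bar>gaussian_log_ratio u P m \<Sigma> x\<bar> \<le> (C + D + \<bar>k\<bar> + 1) * (1 + (norm x)\<^sup>2)" for x
  proof -
    have "\<bar>k\<bar> \<le> (\<bar>k\<bar> + 1) * (1 + (norm x)\<^sup>2)" by (simp add: algebra_simps)
    moreover have "gaussian_log_ratio u P m \<Sigma> x =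
        ((x - u) \<bullet> (matrix_inv P *v (x - u)) - (x - m) \<bullet> (matrix_inv \<Sigma> *v (x - m))) / 2 + k"
      by (simp add: gaussian_log_ratio_def k_def)
    moreover have "\<bar>(a - b) / 2 + c\<bar> \<le> A + B + E" if "\<bar>a\<bar> \<le> A" "\<bar>b\<bar> \<le> B" "\<bar>c\<bar> \<le> E" for a b c A B E :: real
      using that by (simp add: abs_le_iff field_simps)
    ultimately have "\<bar>gaussian_log_ratio u P m \<Sigma> x\<bar>
        \<le> C * (1 + (norm x)\<^sup>2) + D * (1 + (norm x)\<^sup>2) + (\<bar>k\<bar> + 1) * (1 + (norm x)\<^sup>2)"
      using C(2)[of x] D(2)[of x] by metis
    then show ?thesis by (simp only: distrib_right)
  qed
  then show ?thesis using C D by (intro exI[of _ "C + D + \<bar>k\<bar> + 1"]) auto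
qed

text \<open>Dividing the exponent by the growth constant reduces the first claim to the exponential
  moment of the squared norm. The second follows from \<open>t \<le> exp t\<close>.\<close>

lemma gaussian_quadratic_growth_integrable:
  fixes \<Sigma> :: "real^'n^'n"
  assumes \<Sigma>: "positive_definite \<Sigma>" and [measurable]: "\<phi> \<in> borel_measurable borel"
    and C: "0 < C" "\<And>x. \<bar>\<phi> x\<bar> \<le> C * (1 + (norm x)\<^sup>2)"
  shows "\<exists>e>0. integrable (gaussian m \<Sigma>) (\<lambda>x. exp (e * \<bar>\<phi> x\<bar>))"
    and "integrable (gaussian m \<Sigma>) \<phi>"
proof -
  obtain e where e: "0 < e" "integrable (gaussian m \<Sigma>) (\<lambda>x. exp (e * (norm x)\<^sup>2))"
    using gaussian_exp_moment[OF \<Sigma>] by blast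
  have "integrable (gaussian m \<Sigma>) (\<lambda>x. exp e * exp (e * (norm x)\<^sup>2))" using e by simp
  then have i: "integrable (gaussian m \<Sigma>) (\<lambda>x. exp (e / C * \<bar>\<phi> x\<bar>))"
  proof (rule Bochner_Integration.integrable_bound)
    have "e / C * \<bar>\<phi> x\<bar> \<le> e + e * (norm x)\<^sup>2" for x
      using mult_left_mono[OF C(2)[of x], of "e / C"] e C by (simp add: field_simps)
    then show "AE x in gaussian m \<Sigma>. norm (exp (e / C * \<bar>\<phi> x\<bar>)) \<le> norm (exp e * exp (e * (norm x)\<^sup>2))"
      by (simp add: exp_add[symmetric])
  qed simp
  have "0 < e / C" using e C by simp
  then show "\<exists>e>0. integrable (gaussian m \<Sigma>) (\<lambda>x. exp (e * \<bar>\<phi> x\<bar>))" using i by blast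
  have "integrable (gaussian m \<Sigma>) (\<lambda>x. exp (e / C * \<bar>\<phi> x\<bar>) / (e / C))" using i by simp
  then show "integrable (gaussian m \<Sigma>) \<phi>"
  proof (rule Bochner_Integration.integrable_bound)
    have "\<bar>\<phi> x\<bar> \<le> exp (e / C * \<bar>\<phi> x\<bar>) / (e / C)" for x
      using order_trans[OF _ exp_ge_add_one_self, of "e / C * \<bar>\<phi> x\<bar>" "e / C * \<bar>\<phi> x\<bar>"] \<open>0 < e / C\<close>
      by (subst pos_le_divide_eq) (simp_all add: mult.commute)
    then show "AE x in gaussian m \<Sigma>. norm (\<phi> x) \<le> norm (exp (e / C * \<bar>\<phi> x\<bar>) / (e / C))"
      by (intro AE_I2) (metis abs_ge_self order_trans real_norm_def)
  qed simp
qed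

lemma gaussian_log_ratio_integrable:
  fixes \<Sigma>' :: "real^'n^'n"
  assumes \<Sigma>': "positive_definite \<Sigma>'"
  shows "\<exists>e>0. integrable (gaussian m' \<Sigma>') (\<lambda>x. exp (e * \<bar>gaussian_log_ratio u P m \<Sigma> x + k\<bar>))"
    and "integrable (gaussian m' \<Sigma>') (gaussian_log_ratio u P m \<Sigma>)"
proof -
  obtain C where C: "0 < C" "\<And>x. \<bar>gaussian_log_ratio u P m \<Sigma> x\<bar> \<le> C * (1 + (norm x)\<^sup>2)"
    using gaussian_log_ratio_growth by metis
  then show "integrable (gaussian m' \<Sigma>') (gaussian_log_ratio u P m \<Sigma>)"
    by (intro gaussian_quadratic_growth_integrable(2)[OF \<Sigma>' _ C]) simp
  have "\<bar>gaussian_log_ratio u P m \<Sigma> x + k\<bar> \<le> (C + \<bar>k\<bar>) * (1 + (norm x)\<^sup>2)" for x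
  proof -
    have "\<bar>k\<bar> \<le> \<bar>k\<bar> * (1 + (norm x)\<^sup>2)" by (simp add: algebra_simps)
    then show ?thesis using C(2)[of x] by (simp only: distrib_right[of C])
  qed
  moreover have "0 < C + \<bar>k\<bar>" using C by linarith
  ultimately show "\<exists>e>0. integrable (gaussian m' \<Sigma>') (\<lambda>x. exp (e * \<bar>gaussian_log_ratio u P m \<Sigma> x + k\<bar>))"
    by (intro gaussian_quadratic_growth_integrable(1)[OF \<Sigma>']) simp_all
qed


text \<open>In \<open>KL_exp_density\<close> both total masses are one and cancel, which leaves only
  the integral of the log ratio.\<close>

lemma KL_gaussian:
  fixes \<Sigma> R :: "real^'n^'n"
  assumes R: "positive_definite R" and \<Sigma>: "positive_definite \<Sigma>"
  shows "KL (gaussian w R) (gaussian m \<Sigma>) = ennreal (- (\<integral>x. gaussian_log_ratio w R m \<Sigma> x \<partial>gaussian w R))"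
    and "0 \<le> - (\<integral>x. gaussian_log_ratio w R m \<Sigma> x \<partial>gaussian w R)"
    and "integrable (gaussian m \<Sigma>) (\<lambda>x. exp (- gaussian_log_ratio w R m \<Sigma> x))"
    and "(\<integral>x. exp (- gaussian_log_ratio w R m \<Sigma> x) \<partial>gaussian m \<Sigma>) = 1"
proof -
  let ?l = "gaussian_log_ratio w R m \<Sigma>"
  let ?\<mu> = "gaussian m \<Sigma>"
  interpret mu: prob_space ?\<mu> by (rule prob_space_gaussian[OF \<Sigma>])
  interpret R: prob_space "gaussian w R" by (rule prob_space_gaussian[OF R])
  note dens = gaussian_eq_density_gaussian[OF R \<Sigma>, of w m]
  have "(\<integral>\<^sup>+x. ennreal (exp (- ?l x)) \<partial>?\<mu>) = emeasure (gaussian w R) UNIV"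
    unfolding dens by (simp add: emeasure_density)
  also have "\<dots> = 1" using R.emeasure_space_1 by simp
  finally have n: "(\<integral>\<^sup>+x. ennreal (exp (- ?l x)) \<partial>?\<mu>) = 1" .
  then show i: "integrable ?\<mu> (\<lambda>x. exp (- ?l x))" by (intro integrableI_nonneg) simp_all
  show I: "(\<integral>x. exp (- ?l x) \<partial>?\<mu>) = 1" using n by (simp add: integral_eq_nn_integral)
  note k = KL_exp_density[OF mu.finite_measure_axioms _ i dens gaussian_log_ratio_integrable(2)[OF R]]
  show "KL (gaussian w R) ?\<mu> = ennreal (- (\<integral>x. ?l x \<partial>gaussian w R))"
    using k(1) mu.prob_space by (simp add: I)
  show "0 \<le> - (\<integral>x. ?l x \<partial>gaussian w R)"
    using k(2) mu.prob_space by (simp add: I)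
qed

lemma scale_measure_eq_density: "scale_measure c M = density M (\<lambda>_. c)"
  by (rule measure_eqI) (simp_all add: emeasure_density nn_integral_cmult_indicator)

lemma distr_scale_measure:
  assumes "f \<in> measurable M N"
  shows "distr (scale_measure c M) N f = scale_measure c (distr M N f)"
  using assms by (intro measure_eqI) (simp_all add: emeasure_distr measurable_def space_scale_measure)

section \<open>Gaussian potentials, the optimal coupling and the constant\<close>

context uot_gaussian_data
begin

abbreviation "p \<equiv> gaussian u P"
abbreviation "q \<equiv> gaussian v Q"
abbreviation "\<mu>0 \<equiv> gaussian m0 \<Sigma>0"
abbreviation "\<mu>1 \<equiv> gaussian m1 \<Sigma>1"
abbreviation "l0 \<equiv> gaussian_log_ratio u P m0 \<Sigma>0"
abbreviation "l1 \<equiv> gaussian_log_ratio v Q m1 \<Sigma>1"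

definition "T x = v + L *v (x - u)"
text \<open>The gap between cost and unshifted potentials at the contact point
  \<open>(u, v)\<close>, where \<open>T u = v\<close>.\<close>

definition "K = (norm (u - v))\<^sup>2 - (\<tau>0 * l0 u + \<tau>1 * l1 v)"

text \<open>In \<open>z = x - u\<close> and \<open>w = y - v\<close> the linear terms cancel by
  \<open>A0_u\<close> and \<open>A1_v\<close>, as do the parts \<open>z \<bullet> z\<close> and
  \<open>w \<bullet> w\<close>. What is left, \<open>z \<bullet> L z - 2 (z \<bullet> w) + w
  \<bullet> L\<^sup>-\<^sup>1 w\<close>, is a complete square because \<open>L\<close> is
  symmetric.\<close>

lemma duality_gap:
  "(norm (x - y))\<^sup>2 - (\<tau>0 * l0 x + \<tau>1 * l1 y) = K + (y - T x) \<bullet> (matrix_inv L *v (y - T x))"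
proof -
  note inv = matrix_inv_vector[OF positive_definite_invertible[OF positive_definite_L]]
  define z where "z = x - u"
  define w where "w = y - v"
  have xy: "x = u + z" "y = v + w" by (simp_all add: z_def w_def)
  have 0: "\<tau>0 * l0 x = \<tau>0 * l0 u + z \<bullet> (z - L *v z) + 2 * (z \<bullet> h)"
    unfolding xy gaussian_log_ratio_diff[OF \<Sigma>0] matrix_inv_P N_vector A0_u
    using \<tau>0 by (simp add: inner_simps field_simps)
  have 1: "\<tau>1 * l1 y = \<tau>1 * l1 v + w \<bullet> (w - matrix_inv L *v w) - 2 * (w \<bullet> h)"
    unfolding xy gaussian_log_ratio_diff[OF \<Sigma>1] matrix_inv_Q A1_v
    using \<tau>1 by (simp add: inner_simps field_simps)
  have "x - y = h + z - w" using u_minus_v by (simp add: xy algebra_simps)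
  then have c: "(norm (x - y))\<^sup>2 = (norm (u - v))\<^sup>2 + z \<bullet> z + w \<bullet> w + 2 * (z \<bullet> h) - 2 * (w \<bullet> h) - 2 * (z \<bullet> w)"
    unfolding u_minus_v by (simp add: power2_norm_eq_inner inner_simps inner_commute)
  have "(L *v z) \<bullet> (matrix_inv L *v w) = z \<bullet> w"
    using symmetric_matrix_inner[OF positive_definite_symmetric[OF positive_definite_L], of z "matrix_inv L *v w"]
    by (simp add: inv)
  moreover have "y - T x = w - L *v z" by (simp add: T_def w_def z_def)
  ultimately have "(y - T x) \<bullet> (matrix_inv L *v (y - T x)) = w \<bullet> (matrix_inv L *v w) - 2 * (z \<bullet> w) + z \<bullet> (L *v z)"
    by (simp add: matrix_vector_mult_diff_distrib inv inner_simps inner_commute)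
  then show ?thesis by (simp add: 0 1 c K_def inner_simps)
qed

lemma measurable_T [measurable]: "T \<in> borel_measurable borel"
  unfolding T_def[abs_def] by measurable

lemma transport_certificate_shift:
  assumes "k0 + k1 = K"
  shows "transport_certificate (\<lambda>x. \<tau>0 * l0 x + k0) (\<lambda>y. \<tau>1 * l1 y + k1) T"
proof
  note pd = positive_definite_matrix_inv[OF positive_definite_L]
  fix x y
  have gap: "(norm (x - y))\<^sup>2 - ((\<tau>0 * l0 x + k0) + (\<tau>1 * l1 y + k1)) = (y - T x) \<bullet> (matrix_inv L *v (y - T x))"
    using duality_gap[of x y] assms by simp
  show "(\<tau>0 * l0 x + k0) + (\<tau>1 * l1 y + k1) \<le> (norm (x - y))\<^sup>2"
    using gap positive_definite_inner_nonneg[OF pd, of "y - T x"] by linarith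
  show "(\<tau>0 * l0 x + k0) + (\<tau>1 * l1 y + k1) = (norm (x - y))\<^sup>2 \<longleftrightarrow> y = T x"
    using gap positive_definite_inner_eq_0_iff[OF pd, of "y - T x"] by auto
qed simp_all

lemma distr_p_T: "distr p borel T = q"
  using distr_gaussian_affine[OF positive_definite_P positive_definite_invertible[OF positive_definite_L], of u v]
  by (simp add: T_def[abs_def] Q_star_def positive_definite_symmetric[OF positive_definite_L])

lemma prob_spaces: "prob_space p" "prob_space q" "prob_space \<mu>0" "prob_space \<mu>1"
  by (simp_all add: prob_space_gaussian positive_definite_P positive_definite_Q \<Sigma>0 \<Sigma>1)

lemma integrable_l: "integrable p l0" "integrable q l1"
  by (simp_all add: gaussian_log_ratio_integrable(2) positive_definite_P positive_definite_Q)

abbreviation "\<pi> \<equiv> distr p borel (\<lambda>x. (x, T x))"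

lemma is_gaussian_\<pi>: "is_gaussian \<pi>"
  unfolding T_def by (rule is_gaussian_affine_graph[OF positive_definite_P])

lemma shifted_integrable: "integrable p (\<lambda>x. \<tau>0 * l0 x + k)" "integrable q (\<lambda>x. \<tau>1 * l1 x + k)"
  and shifted_integral: "(\<integral>x. \<tau>0 * l0 x + k \<partial>p) = \<tau>0 * (\<integral>x. l0 x \<partial>p) + k"
    "(\<integral>x. \<tau>1 * l1 x + k \<partial>q) = \<tau>1 * (\<integral>x. l1 x \<partial>q) + k"
proof -
  interpret p: prob_space p by (rule prob_spaces)
  interpret q: prob_space q by (rule prob_spaces)
  show "integrable p (\<lambda>x. \<tau>0 * l0 x + k)" "integrable q (\<lambda>x. \<tau>1 * l1 x + k)"
    using integrable_l by simp_all
  show "(\<integral>x. \<tau>0 * l0 x + k \<partial>p) = \<tau>0 * (\<integral>x. l0 x \<partial>p) + k"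
    "(\<integral>x. \<tau>1 * l1 x + k \<partial>q) = \<tau>1 * (\<integral>x. l1 x \<partial>q) + k"
    using integrable_l p.prob_space q.prob_space by simp_all
qed

lemma W2_optimal_coupling_iff_\<pi>: "W2_optimal_coupling p q \<rho> \<longleftrightarrow> \<rho> = \<pi>"
proof -
  \<comment> \<open>With both marginals fixed, every split of \<open>K\<close> between the
    potentials serves equally. The summand 0 preserves the shape of
    \<open>transport_certificate_shift\<close>.\<close>
  interpret transport_certificate "\<lambda>x. \<tau>0 * l0 x + K" "\<lambda>y. \<tau>1 * l1 y + 0" T
    by (rule transport_certificate_shift) simp
  show ?thesis
    using W2_optimal_coupling_iff[of p \<rho>] shifted_integrable(1)[of K] shifted_integrable(2)[of 0]
    unfolding distr_p_T by simp
qed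

text \<open>The squared distance is \<open>\<tau>0 * ?I + K + \<tau>1 * ?J\<close>, and the
  divergences contribute \<open>- ?I\<close> and \<open>- ?J\<close> with the same weights.
  Nonnegativity of \<open>K\<close> is recorded so that \<open>enn2real\<close> returns
  \<open>K\<close> itself.\<close>

lemma A_star_eq: "A_star m0 m1 \<Sigma>0 \<Sigma>1 \<tau>0 \<tau>1 = ennreal K" and K_nonneg: "0 \<le> K"
proof -
  interpret transport_certificate "\<lambda>x. \<tau>0 * l0 x + K" "\<lambda>y. \<tau>1 * l1 y + 0" T
    by (rule transport_certificate_shift) simp
  let ?I = "\<integral>x. l0 x \<partial>p" and ?J = "\<integral>x. l1 x \<partial>q"
  let ?w = "(\<tau>0 * ?I + K) + (\<tau>1 * ?J + 0)"
  have w: "W2_squared p q = ennreal ?w" "0 \<le> ?w"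
    using W2_squared_eq[of p] transport_cost_graph(2)[of p]
      shifted_integrable(1)[of K] shifted_integrable(2)[of 0]
    unfolding distr_p_T shifted_integral by simp_all
  note k = KL_gaussian[OF positive_definite_P \<Sigma>0, of u m0]
  note l = KL_gaussian[OF positive_definite_Q \<Sigma>1, of v m1]
  have eq: "?w + \<tau>0 * (- ?I) + \<tau>1 * (- ?J) = K" by simp
  have "A_star m0 m1 \<Sigma>0 \<Sigma>1 \<tau>0 \<tau>1 = ennreal (?w + \<tau>0 * (- ?I) + \<tau>1 * (- ?J))"
    unfolding A_star_def Let_def p_star_def q_star_def k(1) l(1) w(1)
    by (rule ennreal_add_mults[OF w(2) k(2) l(2) \<tau>0 \<tau>1])
  then show "A_star m0 m1 \<Sigma>0 \<Sigma>1 \<tau>0 \<tau>1 = ennreal K"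
    unfolding eq .
  have "0 \<le> \<tau>0 * (- ?I)" "0 \<le> \<tau>1 * (- ?J)"
    using k(2) l(2) \<tau>0 \<tau>1 by (intro mult_nonneg_nonneg; simp)+
  then show "0 \<le> K" using w(2) eq by linarith
qed

end

text \<open>One side of \<open>uot_certificate\<close>, to be used for each marginal. The shift
  \<open>- \<tau> * ln (M / c)\<close> multiplies the Gaussian density ratio by
  \<open>M / c\<close>, so the reweighted measure acquires mass \<open>M\<close>.\<close>

lemma scaled_gaussian_potential:
  fixes m w :: "real^'n" and R \<Sigma> :: "real^'n^'n" and c M \<tau> :: real
  assumes R: "positive_definite R" and \<Sigma>: "positive_definite \<Sigma>" and c: "0 < c" and M: "0 < M" and \<tau>: "0 < \<tau>"
  defines "\<alpha> \<equiv> scale_measure (ennreal c) (gaussian m \<Sigma>)" and "\<alpha>' \<equiv> scale_measure (ennreal M) (gaussian w R)"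
    and "\<phi> \<equiv> \<lambda>x. \<tau> * gaussian_log_ratio w R m \<Sigma> x + - \<tau> * ln (M / c)"
  shows "finite_measure \<alpha>" and "measure \<alpha> (space \<alpha>) = c"
    and "\<exists>e>0. integrable \<alpha> (\<lambda>x. exp (e * \<bar>\<phi> x / \<tau>\<bar>))"
    and "integrable \<alpha> (\<lambda>x. exp (- (\<phi> x / \<tau>)))"
    and "(\<integral>x. exp (- (\<phi> x / \<tau>)) \<partial>\<alpha>) = M"
    and "\<alpha>' = density \<alpha> (\<lambda>x. ennreal (exp (- (\<phi> x / \<tau>))))"
    and "integrable \<alpha>' \<phi>"
proof -
  let ?l = "gaussian_log_ratio w R m \<Sigma>"
  interpret mu: prob_space "gaussian m \<Sigma>" by (rule prob_space_gaussian[OF \<Sigma>])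
  interpret G: prob_space "gaussian w R" by (rule prob_space_gaussian[OF R])
  have \<alpha>: "\<alpha> = density (gaussian m \<Sigma>) (\<lambda>_. ennreal c)" and \<alpha>': "\<alpha>' = density (gaussian w R) (\<lambda>_. ennreal M)"
    unfolding \<alpha>_def \<alpha>'_def by (rule scale_measure_eq_density)+
  have \<phi>: "\<phi> x / \<tau> = ?l x + - ln (M / c)" for x using \<tau> by (simp add: \<phi>_def field_simps)
  have ex: "exp (- (\<phi> x / \<tau>)) = exp (- ?l x) * (M / c)" for x
    unfolding \<phi> using c M by (simp add: exp_add exp_diff exp_minus field_simps)
  have int: "integrable \<alpha> f \<longleftrightarrow> integrable (gaussian m \<Sigma>) f" if "f \<in> borel_measurable borel" for f :: "real^'n \<Rightarrow> real"
    unfolding \<alpha> using that c by (subst integrable_density) simp_all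
  note l = KL_gaussian[OF R \<Sigma>, where w = w and m = m]
  show "finite_measure \<alpha>"
    using mu.emeasure_space_1
    by (intro finite_measureI) (simp add: \<alpha>_def space_scale_measure)
  show "measure \<alpha> (space \<alpha>) = c"
    using c mu.prob_space by (simp add: \<alpha>_def measure_scale_measure space_scale_measure)
  show "\<exists>e>0. integrable \<alpha> (\<lambda>x. exp (e * \<bar>\<phi> x / \<tau>\<bar>))"
    unfolding \<phi> using gaussian_log_ratio_integrable(1)[OF \<Sigma>, of m w R m \<Sigma> "- ln (M / c)"]
    by (subst int) simp_all
  show "integrable \<alpha> (\<lambda>x. exp (- (\<phi> x / \<tau>)))"
    unfolding ex by (subst int) (use l(3) in simp_all)
  show "(\<integral>x. exp (- (\<phi> x / \<tau>)) \<partial>\<alpha>) = M"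
    unfolding ex \<alpha> using c l(4) by (subst integral_density) simp_all
  show "\<alpha>' = density \<alpha> (\<lambda>x. ennreal (exp (- (\<phi> x / \<tau>))))"
    unfolding ex \<alpha> \<alpha>' gaussian_eq_density_gaussian[OF R \<Sigma>, of w m] using c M
    by (simp add: density_density_eq ennreal_mult'[symmetric] mult.commute)
  show "integrable \<alpha>' \<phi>"
    unfolding \<alpha>' \<phi>_def using M gaussian_log_ratio_integrable(2)[OF R, of w w R m \<Sigma>]
    by (subst integrable_density) simp_all
qed

context uot_gaussian_data
begin

lemma UOT_solution:
  fixes a b :: real
  assumes a: "0 < a" and b: "0 < b"
  defines "M \<equiv> a powr (\<tau>0 / (\<tau>0 + \<tau>1)) * b powr (\<tau>1 / (\<tau>0 + \<tau>1)) * exp (- K / (\<tau>0 + \<tau>1))"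
  shows "is_arg_min (UOT_functional \<tau>0 \<tau>1 (scale_measure (ennreal a) \<mu>0) (scale_measure (ennreal b) \<mu>1))
      (\<lambda>\<gamma>. \<gamma> \<in> finite_borel_measures) \<gamma> \<longleftrightarrow> \<gamma> = scale_measure (ennreal M) \<pi>"
    and "enn2ereal (UOT_value \<tau>0 \<tau>1 (scale_measure (ennreal a) \<mu>0) (scale_measure (ennreal b) \<mu>1))
      = ereal (\<tau>0 * a + \<tau>1 * b - (\<tau>0 + \<tau>1) * M)"
proof -
  have M: "0 < M" using a b by (simp add: M_def)
  \<comment> \<open>The shifts \<open>- \<tau>0 * ln (M / a)\<close> and
    \<open>- \<tau>1 * ln (M / b)\<close> give both marginals mass \<open>M\<close>. Requiring their
    sum to be \<open>K\<close> is an equation for \<open>ln M\<close>, and the formula for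
    \<open>M\<close> is its solution.\<close>
  have "ln M = (\<tau>0 * ln a + \<tau>1 * ln b - K) / (\<tau>0 + \<tau>1)"
    using a b by (simp add: M_def ln_mult ln_powr diff_divide_distrib add_divide_distrib)
  then have "(\<tau>0 + \<tau>1) * ln M = \<tau>0 * ln a + \<tau>1 * ln b - K" using \<tau>0 \<tau>1 by simp
  then have "- \<tau>0 * ln (M / a) + - \<tau>1 * ln (M / b) = K"
    using a b M by (simp add: ln_div algebra_simps)
  then have cert: "transport_certificate (\<lambda>x. \<tau>0 * l0 x + - \<tau>0 * ln (M / a)) (\<lambda>y. \<tau>1 * l1 y + - \<tau>1 * ln (M / b)) T"
    by (rule transport_certificate_shift)
  let ?\<alpha> = "scale_measure (ennreal a) \<mu>0" and ?\<beta> = "scale_measure (ennreal b) \<mu>1"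
  let ?\<alpha>' = "scale_measure (ennreal M) p" and ?\<beta>' = "scale_measure (ennreal M) q"
  note A = scaled_gaussian_potential[OF positive_definite_P \<Sigma>0 a M \<tau>0]
  note B = scaled_gaussian_potential[OF positive_definite_Q \<Sigma>1 b M \<tau>1]
  obtain e0 e1 where e: "0 < e0" "0 < e1"
    "integrable ?\<alpha> (\<lambda>x. exp (e0 * \<bar>(\<tau>0 * l0 x + - \<tau>0 * ln (M / a)) / \<tau>0\<bar>))"
    "integrable ?\<beta> (\<lambda>x. exp (e1 * \<bar>(\<tau>1 * l1 x + - \<tau>1 * ln (M / b)) / \<tau>1\<bar>))"
    using A(3) B(3) by blast
  interpret uot_certificate "\<lambda>x. \<tau>0 * l0 x + - \<tau>0 * ln (M / a)" "\<lambda>y. \<tau>1 * l1 y + - \<tau>1 * ln (M / b)" T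
    ?\<alpha> ?\<beta> ?\<alpha>' ?\<beta>' \<tau>0 \<tau>1 e0 e1
  proof (rule uot_certificate.intro[OF cert], rule uot_certificate_axioms.intro)
    show "distr ?\<alpha>' borel T = ?\<beta>'" by (simp add: distr_scale_measure distr_p_T)
  qed (fact \<tau>0 \<tau>1 A B e | simp)+
  have min: "minimizer = scale_measure (ennreal M) \<pi>"
    unfolding minimizer_def by (rule distr_scale_measure) simp
  then show "is_arg_min (UOT_functional \<tau>0 \<tau>1 ?\<alpha> ?\<beta>) (\<lambda>\<gamma>. \<gamma> \<in> finite_borel_measures) \<gamma> \<longleftrightarrow>
      \<gamma> = scale_measure (ennreal M) \<pi>"
    using is_arg_min_iff by simp
  \<comment> \<open>Each bracket of the dual value is a reference mass minus the common mass of the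
    marginals.\<close>
  have "minimum = \<tau>0 * (a - M) + \<tau>1 * (b - M)"
    unfolding minimum_def A(2,5) B(2,5) ..
  then have "minimum = \<tau>0 * a + \<tau>1 * b - (\<tau>0 + \<tau>1) * M" by (simp add: algebra_simps)
  then show "enn2ereal (UOT_value \<tau>0 \<tau>1 ?\<alpha> ?\<beta>) = ereal (\<tau>0 * a + \<tau>1 * b - (\<tau>0 + \<tau>1) * M)"
    unfolding UOT_value_eq using UOT_functional_minimizer(2) by (simp add: enn2ereal_ennreal)
qed

end

theorem theorem2p1:
  fixes m0 m1 :: "real^'n"
    and \<Sigma>0 \<Sigma>1 :: "real^'n^'n"
    and a b \<tau>0 \<tau>1 :: real
  assumes "positive_definite \<Sigma>0" and "positive_definite \<Sigma>1"
    and "0 < a" and "0 < b" and "0 < \<tau>0" and "0 < \<tau>1"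
  shows
    "let \<alpha> = scale_measure (ennreal a) (gaussian m0 \<Sigma>0);
         \<beta> = scale_measure (ennreal b) (gaussian m1 \<Sigma>1);
         L = L_star \<Sigma>0 \<Sigma>1 \<tau>0 \<tau>1;
         P = P_star \<Sigma>0 \<Sigma>1 \<tau>0 \<tau>1;
         Q = Q_star \<Sigma>0 \<Sigma>1 \<tau>0 \<tau>1;
         u = u_star m0 m1 \<Sigma>0 \<Sigma>1 \<tau>0 \<tau>1;
         v = v_star m0 m1 \<Sigma>0 \<Sigma>1 \<tau>0 \<tau>1;
         p = p_star m0 m1 \<Sigma>0 \<Sigma>1 \<tau>0 \<tau>1;
         q = q_star m0 m1 \<Sigma>0 \<Sigma>1 \<tau>0 \<tau>1;
         A = A_star m0 m1 \<Sigma>0 \<Sigma>1 \<tau>0 \<tau>1;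
         M = a powr (\<tau>0 / (\<tau>0 + \<tau>1)) * b powr (\<tau>1 / (\<tau>0 + \<tau>1))
               * exp (- enn2real A / (\<tau>0 + \<tau>1))
     in positive_definite P \<and> positive_definite Q \<and> A < \<infinity> \<and>
        (\<exists>!\<pi>. is_gaussian \<pi> \<and> W2_optimal_coupling p q \<pi>) \<and>
        (\<forall>\<pi>. is_gaussian \<pi> \<and> W2_optimal_coupling p q \<pi> \<longrightarrow>
           (\<forall>\<gamma>. is_arg_min (UOT_functional \<tau>0 \<tau>1 \<alpha> \<beta>) (\<lambda>\<gamma>. \<gamma> \<in> finite_borel_measures) \<gamma>
                  \<longleftrightarrow> \<gamma> = scale_measure (ennreal M) \<pi>) \<and>
           (\<forall>(\<Omega> :: 'w measure) X. prob_space \<Omega> \<and> X \<in> borel_measurable \<Omega> \<and> distr \<Omega> borel X = p \<longrightarrow>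
              distr \<Omega> borel (\<lambda>\<omega>. v + L *v (X \<omega> - u)) = q \<and>
              distr \<Omega> borel (\<lambda>\<omega>. (X \<omega>, v + L *v (X \<omega> - u))) = \<pi>) \<and>
           (AE (x, y) in \<pi>. y = v + L *v (x - u))) \<and>
        enn2ereal (UOT_value \<tau>0 \<tau>1 \<alpha> \<beta>) = ereal (\<tau>0 * a + \<tau>1 * b - (\<tau>0 + \<tau>1) * M)"
proof -
  interpret uot_gaussian_data m0 m1 \<Sigma>0 \<Sigma>1 \<tau>0 \<tau>1
    using assms by unfold_locales
  have A: "A_star m0 m1 \<Sigma>0 \<Sigma>1 \<tau>0 \<tau>1 < \<infinity>" "enn2real (A_star m0 m1 \<Sigma>0 \<Sigma>1 \<tau>0 \<tau>1) = K"
    by (simp_all add: A_star_eq K_nonneg)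
  have pq: "p_star m0 m1 \<Sigma>0 \<Sigma>1 \<tau>0 \<tau>1 = p" "q_star m0 m1 \<Sigma>0 \<Sigma>1 \<tau>0 \<tau>1 = q"
    by (simp_all add: p_star_def q_star_def)
  have law: "distr \<Omega> borel (\<lambda>\<omega>. v + L *v (X \<omega> - u)) = q \<and>
      distr \<Omega> borel (\<lambda>\<omega>. (X \<omega>, v + L *v (X \<omega> - u))) = \<pi>"
    if [measurable]: "X \<in> borel_measurable \<Omega>" and X: "distr \<Omega> borel X = p"
    for \<Omega> :: "'w measure" and X
  proof
    show "distr \<Omega> borel (\<lambda>\<omega>. v + L *v (X \<omega> - u)) = q"
      unfolding distr_p_T[symmetric] X[symmetric] by (simp add: distr_distr o_def T_def)
    show "distr \<Omega> borel (\<lambda>\<omega>. (X \<omega>, v + L *v (X \<omega> - u))) = \<pi>"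
      unfolding X[symmetric] by (simp add: distr_distr o_def T_def)
  qed
  have ae: "AE (x, y) in \<pi>. y = v + L *v (x - u)"
    by (subst AE_distr_iff) (simp_all add: T_def split_beta')
  \<comment> \<open>Optimality of a coupling is rewritten as equality with the graph coupling, which
    collapses both the unique existence and the quantifier over optimal Gaussian couplings.\<close>
  show ?thesis
    unfolding Let_def pq W2_optimal_coupling_iff_\<pi> A(2)
    using positive_definite_P positive_definite_Q A(1) is_gaussian_\<pi> law ae
      UOT_solution[OF \<open>0 < a\<close> \<open>0 < b\<close>]
    by (auto simp: case_prod_beta')
qed

end
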